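(* Let $p=p_n$ be in the dense regime, i.e. $\sqrt{\log n/n}\ll p\ll1$. Let $\rho_0=1/3$, fix $\beta_0\in(\sqrt{25/27},1)$, and let $\eta>0$ satisfy $2-\rho_0+\eta-\frac{2\beta_0^2}{1+(\rho_0+\eta)^2}<0$. For graph pairs $(G^1,\mathsf{G}),(G^2,\mathsf{G})$, let $\mathcal{E}_{\mathrm{FS}}$ be the event that there exist $\pi_i\in\mathrm{S}_{\beta_0}(G^i,\mathsf{G})$, $i=1,2$, such that $$\mathrm{overlap}(\pi_1,\pi_2)\in\big((\rho_0-\eta)n,(\rho_0+\eta)n\big).$$ Then for any $\alpha\in[0,1]$, $$\mathbb{P}\big[\mathcal{E}_{\mathrm{FS}}\text{ happens for }(G^1,\mathsf{G}),(G^2,\mathsf{G})\big]=o(1/n^2)\quad\text{as }n\to\infty,$$ where the probability is over a $(2,\alpha)$-correlated instance $(G^1,G^2)$ together with another independent $\mathsf{G}\sim\mathbf{G}(n,p)$.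
   Context: $\mathbf{G}(n,p)$ is the law of the Erdős–Rényi graph on $n$ labelled vertices with edge density $p$. For graphs with $0/1$ adjacency entries $G_{i,j},\mathsf{G}_{i,j}$ and $\pi\in\mathrm{S}_n$, set $\mathrm{O}(\pi)=\sum_{1\le i<j\le n}G_{i,j}\mathsf{G}_{\pi(i),\pi(j)}$ and $\widetilde{\mathrm{O}}(\pi)=\mathrm{O}(\pi)-\binom n2p^2$. With $D_{n,p}=\sqrt{n^3p^2\log n}$, let $\mathrm{S}_\beta(G,\mathsf{G})=\{\pi\in\mathrm{S}_n:\widetilde{\mathrm{O}}(\pi)\ge\beta D_{n,p}\}$. Let $\mathrm{overlap}(\pi_1,\pi_2)=\#\{i\in[n]:\pi_1(i)=\pi_2(i)\}$. Let $N=\binom n2$ and list the pairs $(i,j)$, $1\le i<j\le n$, as $e_1,\dots,e_N$ ordered by increasing $j$ and then increasing $i$: $e_1=(1,2),e_2=(1,3),e_3=(2,3),\dots,e_N=(n-1,n)$. For $\alpha\in[0,1]$, a $(2,\alpha)$-correlated instance is a random pair of graphs $(G^1,G^2)$ on $[n]$ with $G^1_{e_k}=G^2_{e_k}$ for $1\le k\le\lfloor\alpha N\rfloor$, where these common entries together with all entries $G^i_{e_k}$, $\lfloor\alpha N\rfloor+1\le k\le N$, $i=1,2$, are independent Bernoulli($p$) variables. $f\ll g$ means $f/g\to0$ as $n\to\infty$. *)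

theory Defs
  imports
    "HOL-Probability.Probability"
    "HOL-Combinatorics.Permutations"
    "HOL-Library.Landau_Symbols"
begin

text \<open>A graph on \<open>{1..n}\<close> is represented by its set of edges, an edge being a two-element set.\<close>

type_synonym graph = "nat set set"

definition adj :: "graph \<Rightarrow> nat \<Rightarrow> nat \<Rightarrow> real" where
  "adj G i j = of_bool ({i, j} \<in> G)"

text \<open>The pairs \<open>{i, j}\<close>, \<open>1 \<le> i < j \<le> n\<close>, by increasing \<open>j\<close> and then increasing \<open>i\<close>.
  The \<open>k\<close>-th pair, counted from 1, is the entry at position \<open>k - 1\<close>.\<close>

definition edge_list :: "nat \<Rightarrow> nat set list" where
  "edge_list n = concat (map (\<lambda>j. map (\<lambda>i. {i, j}) [1..<j]) [1..<Suc n])"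

lemma edge_list_Suc: "edge_list (Suc n) = edge_list n @ map (\<lambda>i. {i, Suc n}) [1..<Suc n]"
  by (simp add: edge_list_def)

lemma length_edge_list: "length (edge_list n) = n choose 2"
proof (induction n)
  case 0
  show ?case by (simp add: edge_list_def)
next
  case (Suc n)
  then show ?case by (simp add: edge_list_Suc numeral_2_eq_2)
qed

lemma set_edge_list: "set (edge_list n) = {{i, j} | i j. 1 \<le> i \<and> i < j \<and> j \<le> n}"
  by (fastforce simp: edge_list_def)

lemma distinct_edge_list: "distinct (edge_list n)"
proof (induction n)
  case 0
  show ?case by (simp add: edge_list_def)
next
  case (Suc n)
  have "inj_on (\<lambda>i. {i, Suc n}) (set [1..<Suc n])"
    by (auto simp: inj_on_def doubleton_eq_iff)
  moreover have "set (edge_list n) \<inter> set (map (\<lambda>i. {i, Suc n}) [1..<Suc n]) = {}"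
    by (auto simp: set_edge_list doubleton_eq_iff)
  ultimately show ?case
    using Suc by (simp only: edge_list_Suc distinct_append distinct_map distinct_upt)
qed

text \<open>Each pair in the finite set \<open>A\<close> is an edge independently with probability \<open>p\<close>.\<close>

definition random_edges :: "nat set set \<Rightarrow> real \<Rightarrow> graph pmf" where
  "random_edges A p = map_pmf (\<lambda>x. {e \<in> A. x e}) (Pi_pmf A False (\<lambda>_. bernoulli_pmf p))"

definition erdos_renyi :: "nat \<Rightarrow> real \<Rightarrow> graph pmf" where
  "erdos_renyi n p = random_edges (set (edge_list n)) p"

definition correlated_instance :: "nat \<Rightarrow> real \<Rightarrow> real \<Rightarrow> (graph \<times> graph) pmf" where
  "correlated_instance n p \<alpha> =
    (let m = nat \<lfloor>\<alpha> * real (n choose 2)\<rfloor>;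
         common = random_edges (set (take m (edge_list n))) p;
         private = random_edges (set (drop m (edge_list n))) p
     in map_pmf (\<lambda>(C, A\<^sub>1, A\<^sub>2). (C \<union> A\<^sub>1, C \<union> A\<^sub>2))
          (pair_pmf common (pair_pmf private private)))"

definition edge_overlap :: "nat \<Rightarrow> graph \<Rightarrow> graph \<Rightarrow> (nat \<Rightarrow> nat) \<Rightarrow> real" where
  "edge_overlap n G H \<pi> = (\<Sum>j = 1..n. \<Sum>i = 1..<j. adj G i j * adj H (\<pi> i) (\<pi> j))"

definition centered_overlap :: "nat \<Rightarrow> real \<Rightarrow> graph \<Rightarrow> graph \<Rightarrow> (nat \<Rightarrow> nat) \<Rightarrow> real" where
  "centered_overlap n p G H \<pi> = edge_overlap n G H \<pi> - real (n choose 2) * p\<^sup>2"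

definition scale_D :: "nat \<Rightarrow> real \<Rightarrow> real" where
  "scale_D n p = sqrt (real n ^ 3 * p\<^sup>2 * ln (real n))"

definition good_perms :: "nat \<Rightarrow> real \<Rightarrow> real \<Rightarrow> graph \<Rightarrow> graph \<Rightarrow> (nat \<Rightarrow> nat) set" where
  "good_perms n p \<beta> G H =
    {\<pi>. \<pi> permutes {1..n} \<and> centered_overlap n p G H \<pi> \<ge> \<beta> * scale_D n p}"

definition perm_overlap :: "nat \<Rightarrow> (nat \<Rightarrow> nat) \<Rightarrow> (nat \<Rightarrow> nat) \<Rightarrow> nat" where
  "perm_overlap n \<pi>\<^sub>1 \<pi>\<^sub>2 = card {i \<in> {1..n}. \<pi>\<^sub>1 i = \<pi>\<^sub>2 i}"

definition forbidden_structure ::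
    "nat \<Rightarrow> real \<Rightarrow> real \<Rightarrow> real \<Rightarrow> real \<Rightarrow> graph \<Rightarrow> graph \<Rightarrow> graph \<Rightarrow> bool" where
  "forbidden_structure n p \<beta> \<rho> \<eta> G\<^sub>1 G\<^sub>2 H \<longleftrightarrow>
    (\<exists>\<pi>\<^sub>1 \<in> good_perms n p \<beta> G\<^sub>1 H. \<exists>\<pi>\<^sub>2 \<in> good_perms n p \<beta> G\<^sub>2 H.
       real (perm_overlap n \<pi>\<^sub>1 \<pi>\<^sub>2) \<in> {(\<rho> - \<eta>) * real n <..< (\<rho> + \<eta>) * real n})"

end

theory Submission
  imports Defs "HOL-Real_Asymp.Real_Asymp"
begin

text \<open>A union bound over pairs of permutations is combined with a Chernoff bound for
  \<open>O(\<pi>\<^sub>1) + O(\<pi>\<^sub>2)\<close>. There are at most \<open>exp ((2 - \<rho> + o(1)) n ln n)\<close> pairs with overlap above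
  \<open>\<rho> n\<close>. Averaging over the correlated pair given \<open>H\<close> turns the exponential moment into that of
  \<open>2 p a |H| + p a\<^sup>2 #{f. f, \<sigma> f \<in> H}\<close>, where \<open>a = exp \<theta> - 1\<close> and \<open>\<sigma>\<close> is the action on edges
  of \<open>\<pi>\<^sub>2\<close> after the inverse of \<open>\<pi>\<^sub>1\<close>; this bound does not depend on \<open>\<alpha>\<close>. The at most
  \<open>(\<rho> n)\<^sup>2 / 2 + n\<close> edges fixed by \<open>\<sigma>\<close> increase the variance from \<open>n\<^sup>2 p\<^sup>2\<close> to
  \<open>n\<^sup>2 p\<^sup>2 (1 + \<rho>\<^sup>2)\<close>, whereas the other edges contribute only a factor \<open>1 + O(p)\<close> to it. Optimizing
  \<open>\<theta>\<close> yields \<open>exp (- 2 \<beta>\<^sup>2 / (1 + \<rho>\<^sup>2) n ln n)\<close>; the dense regime is what makes this \<open>\<theta>\<close> tend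
  to 0.\<close>

section \<open>Expectations over random edge sets\<close>

lemma finite_set_pmf_random_edges: "finite A \<Longrightarrow> finite (set_pmf (random_edges A p))"
  by (rule finite_subset[of _ "Pow A"]) (auto simp: random_edges_def)

lemma set_pmf_random_edges: "set_pmf (random_edges A p) \<subseteq> Pow A"
  by (auto simp: random_edges_def)

lemma expectation_mono_finite:
  fixes f g :: "'a \<Rightarrow> real"
  assumes "finite (set_pmf M)" "\<And>x. x \<in> set_pmf M \<Longrightarrow> f x \<le> g x"
  shows "measure_pmf.expectation M f \<le> measure_pmf.expectation M g"
  by (rule integral_mono_AE) (auto intro: integrable_measure_pmf_finite assms AE_pmfI)

text \<open>Fubini; finite supports make every function integrable and turn the outer integral into
  a finite sum.\<close>

lemma expectation_pair_pmf_finite: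
  fixes f :: "'a \<times> 'b \<Rightarrow> real"
  assumes "finite (set_pmf M)" "finite (set_pmf N)"
  shows "measure_pmf.expectation (pair_pmf M N) f =
    measure_pmf.expectation M (\<lambda>x. measure_pmf.expectation N (\<lambda>y. f (x, y)))"
proof -
  have "measure_pmf.expectation (pair_pmf M N) f =
    (\<Sum>a\<in>set_pmf M. pmf M a *\<^sub>R
       measure_pmf.expectation (N \<bind> (\<lambda>y. return_pmf (a, y))) f)"
    unfolding pair_pmf_def using assms by (intro pmf_expectation_bind) auto
  also have "\<dots> = (\<Sum>a\<in>set_pmf M. measure_pmf.expectation N (\<lambda>y. f (a, y)) * pmf M a)"
    by (simp add: map_pmf_def[symmetric] mult.commute)
  also have "\<dots> = measure_pmf.expectation M (\<lambda>x. measure_pmf.expectation N (\<lambda>y. f (x, y)))"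
    using assms by (intro integral_measure_pmf_real[symmetric]) auto
  finally show ?thesis .
qed

text \<open>Independence of the edge indicators. The exponential moments below are all reduced to
  products of this form.\<close>

lemma expectation_random_edges_prod:
  fixes f :: "nat set \<Rightarrow> bool \<Rightarrow> real"
  assumes "finite A" "0 \<le> p" "p \<le> 1" "\<And>e b. e \<in> A \<Longrightarrow> 0 \<le> f e b"
  shows "measure_pmf.expectation (random_edges A p) (\<lambda>S. \<Prod>e\<in>A. f e (e \<in> S)) =
    (\<Prod>e\<in>A. p * f e True + (1 - p) * f e False)"
proof -
  have "measure_pmf.expectation (random_edges A p) (\<lambda>S. \<Prod>e\<in>A. f e (e \<in> S)) =
    measure_pmf.expectation (Pi_pmf A False (\<lambda>_. bernoulli_pmf p)) (\<lambda>x. \<Prod>e\<in>A. f e (x e))"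
    by (simp add: random_edges_def cong: prod.cong)
  also have "\<dots> = (\<Prod>e\<in>A. measure_pmf.expectation (bernoulli_pmf p) (f e))"
    using assms by (intro expectation_prod_Pi_pmf integrable_measure_pmf_finite) auto
  finally show ?thesis
    using assms by (simp add: mult.commute)
qed

text \<open>Allows one block of edges to be averaged while the other stays fixed.\<close>

lemma random_edges_union:
  assumes "finite A" "finite B" "A \<inter> B = {}"
  shows "random_edges (A \<union> B) p =
    map_pmf (\<lambda>(S, T). S \<union> T) (pair_pmf (random_edges A p) (random_edges B p))"
  unfolding random_edges_def Pi_pmf_union[OF assms] map_pair[symmetric] map_pmf_comp
  by (intro map_pmf_cong) (use assms in auto)

text \<open>The hypotheses make the pairs \<open>{f, \<sigma> f}\<close> with \<open>f \<in> C\<close> pairwise disjoint, so that the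
  expectation factorizes over these pairs and the remaining edges.\<close>

lemma expectation_disjoint_pairs:
  fixes w :: "nat set \<Rightarrow> real" and \<sigma> :: "nat set \<Rightarrow> nat set"
  assumes fin: "finite A" and C: "C \<subseteq> A" and inj: "inj_on \<sigma> C" and img: "\<sigma> ` C \<subseteq> A - C"
    and p: "0 \<le> p" "p \<le> 1" and b: "0 \<le> b" and w: "\<And>e. e \<in> A \<Longrightarrow> 1 \<le> w e"
  shows "measure_pmf.expectation (random_edges A p)
      (\<lambda>S. (\<Prod>e\<in>A. if e \<in> S then w e else 1) *
           (\<Prod>e\<in>C. if e \<in> S \<and> \<sigma> e \<in> S then 1 + b else 1))
    \<le> exp ((\<Sum>e\<in>A. p * (w e - 1)) + (\<Sum>e\<in>C. p\<^sup>2 * b * w e * w (\<sigma> e)))"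
proof -
  define R where "R = A - C"
  have finC: "finite C" and finR: "finite R" and CR: "C \<inter> R = {}" and A: "A = C \<union> R"
    using fin C by (auto simp: R_def intro: finite_subset)
  have wC: "1 \<le> w e" if "e \<in> C" for e using w C that by blast
  have wR: "1 \<le> w e" if "e \<in> R" for e using w that by (auto simp: R_def)
  \<comment> \<open>\<open>h e x\<close> is the average of the factors attached to \<open>e\<close>
    when \<open>x\<close> tells whether \<open>\<sigma> e\<close> is present.\<close>
  define h where "h e x = p * (w e * (if x then 1 + b else 1)) + (1 - p)" for e x
  have h0: "0 \<le> h e x" if "e \<in> C" for e x
    using p b wC[OF that] by (auto simp: h_def intro!: add_nonneg_nonneg mult_nonneg_nonneg)
  define \<tau> where "\<tau> = inv_into C \<sigma>"
  \<comment> \<open>\<open>u\<close> carries \<open>h\<close> along \<open>\<sigma>\<close> to the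
    edges of \<open>R\<close>; the default 1 is neutral off the image of \<open>C\<close>.\<close>
  define u where "u e x = (if e \<in> \<sigma> ` C then h (\<tau> e) x else 1)" for e x
  have \<tau>: "\<tau> (\<sigma> e) = e" if "e \<in> C" for e
    using inj that by (simp add: \<tau>_def)
  have u0: "0 \<le> u e x" for e x
    using h0 \<tau> by (auto simp: u_def)
  have inner: "measure_pmf.expectation (random_edges C p)
      (\<lambda>S. \<Prod>e\<in>C. if e \<in> S then w e * (if \<sigma> e \<in> T then 1 + b else 1) else 1)
      = (\<Prod>e\<in>R. u e (e \<in> T))" for T
  proof -
    have "measure_pmf.expectation (random_edges C p)
      (\<lambda>S. \<Prod>e\<in>C. (\<lambda>e x. if x then w e * (if \<sigma> e \<in> T then 1 + b else 1) else 1) e (e \<in> S))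
      = (\<Prod>e\<in>C. h e (\<sigma> e \<in> T))"
      using order_trans[OF zero_le_one wC] b
      by (subst expectation_random_edges_prod[OF finC p]) (auto simp: h_def)
    also have "\<dots> = (\<Prod>e\<in>C. u (\<sigma> e) (\<sigma> e \<in> T))"
      by (intro prod.cong) (auto simp: u_def \<tau>)
    also have "\<dots> = (\<Prod>e\<in>\<sigma> ` C. u e (e \<in> T))"
      by (simp add: prod.reindex[OF inj])
    also have "\<dots> = (\<Prod>e\<in>R. u e (e \<in> T))"
      using img finR by (intro prod.mono_neutral_left) (auto simp: u_def R_def)
    finally show ?thesis by simp
  qed
  let ?F = "\<lambda>S. (\<Prod>e\<in>A. if e \<in> S then w e else 1) *
           (\<Prod>e\<in>C. if e \<in> S \<and> \<sigma> e \<in> S then 1 + b else 1)"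
  \<comment> \<open>Every pair has its first edge in \<open>C\<close> and its second in
    \<open>R\<close>. Once \<open>T\<close> is fixed, the integrand is therefore a product over
    \<open>C\<close> times a constant.\<close>
  have split: "?F (S \<union> T) =
      (\<Prod>e\<in>R. if e \<in> T then w e else 1) *
      (\<Prod>e\<in>C. if e \<in> S then w e * (if \<sigma> e \<in> T then 1 + b else 1) else 1)"
    if "S \<subseteq> C" "T \<subseteq> R" for S T
  proof -
    have "(\<Prod>e\<in>A. if e \<in> S \<union> T then w e else 1) =
      (\<Prod>e\<in>C. if e \<in> S \<union> T then w e else 1) * (\<Prod>e\<in>R. if e \<in> S \<union> T then w e else 1)"
      unfolding A using finC finR CR by (intro prod.union_disjoint) auto
    also have "(\<Prod>e\<in>C. if e \<in> S \<union> T then w e else 1) = (\<Prod>e\<in>C. if e \<in> S then w e else 1)"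
      using that CR by (intro prod.cong) auto
    also have "(\<Prod>e\<in>R. if e \<in> S \<union> T then w e else 1) = (\<Prod>e\<in>R. if e \<in> T then w e else 1)"
      using that CR by (intro prod.cong) auto
    moreover have "(\<Prod>e\<in>C. if e \<in> S \<union> T \<and> \<sigma> e \<in> S \<union> T then 1 + b else 1) =
      (\<Prod>e\<in>C. if e \<in> S \<and> \<sigma> e \<in> T then 1 + b else 1)"
      using that CR img by (intro prod.cong) (auto simp: R_def)
    moreover have "(\<Prod>e\<in>C. if e \<in> S then w e * (if \<sigma> e \<in> T then 1 + b else 1) else 1) =
      (\<Prod>e\<in>C. if e \<in> S then w e else 1) * (\<Prod>e\<in>C. if e \<in> S \<and> \<sigma> e \<in> T then 1 + b else 1)"
      unfolding prod.distrib[symmetric] by (intro prod.cong) auto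
    ultimately show ?thesis by (simp add: mult_ac)
  qed
  \<comment> \<open>The order of the two blocks is swapped so that \<open>C\<close> is averaged
    first, given the edges in \<open>R\<close>.\<close>
  have "measure_pmf.expectation (random_edges A p) ?F =
      measure_pmf.expectation (pair_pmf (random_edges R p) (random_edges C p))
        (\<lambda>(T, S). ?F (S \<union> T))"
    unfolding A random_edges_union[OF finC finR CR]
    by (subst pair_commute_pmf) (simp add: map_pmf_comp case_prod_unfold)
  also have "\<dots> = measure_pmf.expectation (random_edges R p)
      (\<lambda>T. measure_pmf.expectation (random_edges C p) (\<lambda>S. ?F (S \<union> T)))"
    by (simp add: expectation_pair_pmf_finite finite_set_pmf_random_edges finC finR)
  also have "\<dots> = measure_pmf.expectation (random_edges R p)
      (\<lambda>T. \<Prod>e\<in>R. (\<lambda>e x. (if x then w e else 1) * u e x) e (e \<in> T))"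
  proof (intro integral_cong_AE AE_pmfI)
    fix T assume "T \<in> set_pmf (random_edges R p)"
    then have T: "T \<subseteq> R" using set_pmf_random_edges by blast
    have "measure_pmf.expectation (random_edges C p) (\<lambda>S. ?F (S \<union> T)) =
      measure_pmf.expectation (random_edges C p) (\<lambda>S. (\<Prod>e\<in>R. if e \<in> T then w e else 1) *
      (\<Prod>e\<in>C. if e \<in> S then w e * (if \<sigma> e \<in> T then 1 + b else 1) else 1))"
      by (intro integral_cong_AE AE_pmfI split)
        (use set_pmf_random_edges T in \<open>simp_all, blast\<close>)
    then show "measure_pmf.expectation (random_edges C p) (\<lambda>S. ?F (S \<union> T)) =
      (\<Prod>e\<in>R. (\<lambda>e x. (if x then w e else 1) * u e x) e (e \<in> T))"
      by (simp add: inner prod.distrib)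
  qed auto
  also have "\<dots> = (\<Prod>e\<in>R. p * (w e * u e True) + (1 - p) * u e False)"
    using order_trans[OF zero_le_one wR] u0
    by (subst expectation_random_edges_prod[OF finR p]) auto
  also have "\<dots> \<le> exp (\<Sum>e\<in>R. p * (w e - 1) +
      (if e \<in> \<sigma> ` C then p * (w (\<tau> e) - 1) + p\<^sup>2 * b * w (\<tau> e) * w e else 0))"
  proof -
    have "(\<Prod>e\<in>R. p * (w e * u e True) + (1 - p) * u e False) \<le>
      (\<Prod>e\<in>R. exp (p * (w e - 1) +
      (if e \<in> \<sigma> ` C then p * (w (\<tau> e) - 1) + p\<^sup>2 * b * w (\<tau> e) * w e else 0)))"
    proof (intro prod_mono conjI)
      fix e assume e: "e \<in> R"
      have we: "1 \<le> w e" using wR e .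
      show "0 \<le> p * (w e * u e True) + (1 - p) * u e False"
        using p we u0 by (intro add_nonneg_nonneg mult_nonneg_nonneg) auto
      show "p * (w e * u e True) + (1 - p) * u e False \<le> exp (p * (w e - 1) +
        (if e \<in> \<sigma> ` C then p * (w (\<tau> e) - 1) + p\<^sup>2 * b * w (\<tau> e) * w e else 0))"
      proof (cases "e \<in> \<sigma> ` C")
        case True
        then have "1 \<le> w (\<tau> e)" using wC \<tau> by auto
        \<comment> \<open>\<open>x\<close> and \<open>y\<close> are the contributions of an edge and
          of its partner alone; \<open>z\<close> is the surplus when both are present.\<close>
        define x where "x = p * (w e - 1)"
        define y where "y = p * (w (\<tau> e) - 1)"
        define z where "z = p\<^sup>2 * b * w (\<tau> e) * w e"
        have nn: "0 \<le> x" "0 \<le> y" "0 \<le> z"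
          using p b we \<open>1 \<le> w (\<tau> e)\<close> by (auto simp: x_def y_def z_def)
        have "p * (w e * u e True) + (1 - p) * u e False = (1 + x) * (1 + y) + z"
          using True by (simp add: u_def h_def x_def y_def z_def algebra_simps power2_eq_square)
        \<comment> \<open>The surplus can be turned into a factor because
          \<open>(1 + x) * (1 + y)\<close> is at least 1, the weights being at least 1.\<close>
        also have "\<dots> \<le> (1 + x) * (1 + y) * (1 + z)"
        proof -
          have "z \<le> (1 + x) * (1 + y) * z"
            using nn mult_mono[of 1 "1+x" 1 "1+y"] by (intro mult_le_cancel_right1[THEN iffD2]) auto
          then show ?thesis by (simp add: algebra_simps)
        qed
        also have "\<dots> \<le> exp x * exp y * exp z"
          using nn by (intro mult_mono exp_ge_add_one_self) auto
        finally show ?thesis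
          using True by (simp add: exp_add x_def y_def z_def)
      next
        case False
        then show ?thesis
          using exp_ge_add_one_self[of "p * (w e - 1)"] by (simp add: u_def algebra_simps)
      qed
    qed
    then show ?thesis by (simp add: exp_sum finR)
  qed
  also have "(\<Sum>e\<in>R. p * (w e - 1) +
      (if e \<in> \<sigma> ` C then p * (w (\<tau> e) - 1) + p\<^sup>2 * b * w (\<tau> e) * w e else 0)) =
      (\<Sum>e\<in>R. p * (w e - 1)) +
      (\<Sum>e\<in>\<sigma> ` C. p * (w (\<tau> e) - 1) + p\<^sup>2 * b * w (\<tau> e) * w e)"
  proof -
    have "(\<Sum>e\<in>R. if e \<in> \<sigma> ` C then p * (w (\<tau> e) - 1) + p\<^sup>2 * b * w (\<tau> e) * w e else 0) =
      (\<Sum>e\<in>\<sigma> ` C. p * (w (\<tau> e) - 1) + p\<^sup>2 * b * w (\<tau> e) * w e)"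
      using img finR by (intro sum.mono_neutral_cong_right) (auto simp: R_def)
    then show ?thesis by (simp add: sum.distrib)
  qed
  also have "(\<Sum>e\<in>\<sigma> ` C. p * (w (\<tau> e) - 1) + p\<^sup>2 * b * w (\<tau> e) * w e) =
      (\<Sum>e\<in>C. p * (w e - 1)) + (\<Sum>e\<in>C. p\<^sup>2 * b * w e * w (\<sigma> e))"
    by (simp add: sum.reindex[OF inj] \<tau> sum.distrib)
  also have "(\<Sum>e\<in>R. p * (w e - 1)) + ((\<Sum>e\<in>C. p * (w e - 1)) + (\<Sum>e\<in>C. p\<^sup>2 * b * w e * w (\<sigma> e)))
      = (\<Sum>e\<in>A. p * (w e - 1)) + (\<Sum>e\<in>C. p\<^sup>2 * b * w e * w (\<sigma> e))"
    unfolding A using finC finR CR by (subst sum.union_disjoint) auto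
  finally show ?thesis .
qed

section \<open>Three-colouring and the quadratic exponential moment\<close>

text \<open>Joining each \<open>f\<close> to \<open>\<sigma> f\<close> gives a graph of degree at
  most 2, so a greedy choice among three colours succeeds. Two colours would fail on an odd cycle of
  length at least 3.\<close>

lemma three_colouring:
  assumes "finite A" "inj_on \<sigma> A"
  obtains c :: "'a \<Rightarrow> nat" where "c ` A \<subseteq> {0, 1, 2}"
    "\<And>f. f \<in> A \<Longrightarrow> \<sigma> f \<in> A \<Longrightarrow> \<sigma> f \<noteq> f \<Longrightarrow> c f \<noteq> c (\<sigma> f)"
proof -
  have "\<exists>c :: 'a \<Rightarrow> nat. c ` A \<subseteq> {0, 1, 2} \<and> (\<forall>f\<in>A. \<sigma> f \<in> A \<longrightarrow> \<sigma> f \<noteq> f \<longrightarrow> c f \<noteq> c (\<sigma> f))"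
    using assms
  proof (induction rule: finite_induct)
    case (insert x A)
    then obtain c :: "'a \<Rightarrow> nat" where c: "c ` A \<subseteq> {0, 1, 2}"
      "\<And>f. f \<in> A \<Longrightarrow> \<sigma> f \<in> A \<Longrightarrow> \<sigma> f \<noteq> f \<Longrightarrow> c f \<noteq> c (\<sigma> f)"
      by auto
    have ex: "\<exists>k\<in>{0, 1, 2}. k \<noteq> a \<and> k \<noteq> b" for a b :: nat
      by (cases "a = 0 \<or> b = 0"; cases "a = 1 \<or> b = 1") auto
    \<comment> \<open>The new point has at most two neighbours, its image and its preimage. Without
      a preimage, \<open>inv_into\<close> returns an arbitrary point, and avoiding its colour does
      no harm.\<close>
    obtain k where k: "k \<in> {0, 1, 2}" "k \<noteq> c (\<sigma> x)" "k \<noteq> c (inv_into (insert x A) \<sigma> x)"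
      using ex[of "c (\<sigma> x)" "c (inv_into (insert x A) \<sigma> x)"] by blast
    have pre: "inv_into (insert x A) \<sigma> x = f" if "f \<in> A" "\<sigma> f = x" for f
      using inv_into_f_f[OF insert.prems, of f] that by auto
    have "(c(x := k)) ` insert x A \<subseteq> {0, 1, 2}"
      using c(1) k(1) by auto
    moreover have "(c(x := k)) f \<noteq> (c(x := k)) (\<sigma> f)"
      if "f \<in> insert x A" "\<sigma> f \<in> insert x A" "\<sigma> f \<noteq> f" for f
    proof (cases "f = x")
      case True
      then show ?thesis using that k(2) by auto
    next
      case False
      then show ?thesis using that c(2)[of f] k(3) pre[of f] by auto
    qed
    ultimately show ?case by blast
  qed simp
  then show ?thesis using that by blast
qed

text \<open>AM-GM for three cubes, from the factorization of
  \<open>x ^ 3 + y ^ 3 + z ^ 3 - 3 * x * y * z\<close>. It serves in place of Hoelder's inequality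
  with three equal exponents and avoids roots of expectations.\<close>

lemma mult3_le_sum_cubes:
  fixes x y z :: real
  assumes "0 \<le> x" "0 \<le> y" "0 \<le> z"
  shows "x * y * z \<le> (x ^ 3 + y ^ 3 + z ^ 3) / 3"
proof -
  have "0 \<le> (x + y + z) * ((x - y)\<^sup>2 + (y - z)\<^sup>2 + (z - x)\<^sup>2)"
    using assms by (intro mult_nonneg_nonneg) auto
  also have "\<dots> = 2 * (x ^ 3 + y ^ 3 + z ^ 3) - 6 * (x * y * z)"
    by (simp add: power2_eq_square power3_eq_cube algebra_simps)
  finally show ?thesis by simp
qed

lemma sum_of_bool_mem: "finite A \<Longrightarrow> (\<Sum>e\<in>A. of_bool (P e)) = real (card {e \<in> A. P e})"
  by (simp add: of_bool_def sum.If_cases Int_def)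

lemma exp_card_eq_prod:
  "finite A \<Longrightarrow> exp (t * real (card {e \<in> A. P e})) = (\<Prod>e\<in>A. if P e then exp t else 1)"
  by (simp add: prod.If_cases Int_def exp_of_nat2_mult)

text \<open>The nonfixed edges are 3-coloured so that \<open>f\<close> and \<open>\<sigma> f\<close> never share a colour; the inequality
  \<open>x y z \<le> (x\<^sup>3 + y\<^sup>3 + z\<^sup>3) / 3\<close> then reduces the expectation to the three colour classes,
  each of which consists of disjoint pairs.\<close>

lemma expectation_exp_quadratic:
  fixes \<sigma> :: "nat set \<Rightarrow> nat set"
  assumes fin: "finite A" and \<sigma>: "bij_betw \<sigma> A A"
    and p: "0 \<le> p" "p \<le> 1" and s: "0 \<le> s" and \<epsilon>: "0 \<le> \<epsilon>"
  shows "measure_pmf.expectation (random_edges A p)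
      (\<lambda>S. exp (s * real (card {e \<in> A. e \<in> S}) + \<epsilon> * real (card {e \<in> A. e \<in> S \<and> \<sigma> e \<in> S})))
    \<le> exp (real (card A) * (p * (exp s - 1))
        + real (card {e \<in> A. \<sigma> e = e}) * (p * exp s * (exp \<epsilon> - 1))
        + real (card A) * (p\<^sup>2 * exp (2 * (s + \<epsilon>)) * (exp (3 * \<epsilon>) - 1)))"
    (is "?E \<le> exp ?B")
proof -
  have inj: "inj_on \<sigma> A" and img: "\<sigma> ` A = A"
    using \<sigma> by (auto simp: bij_betw_def)
  obtain c :: "nat set \<Rightarrow> nat" where c: "c ` A \<subseteq> {0, 1, 2}"
    "\<And>f. f \<in> A \<Longrightarrow> \<sigma> f \<in> A \<Longrightarrow> \<sigma> f \<noteq> f \<Longrightarrow> c f \<noteq> c (\<sigma> f)"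
    using three_colouring[OF fin inj] by blast
  define C where "C k = {f \<in> A. \<sigma> f \<noteq> f \<and> c f = k}" for k
  \<comment> \<open>An edge fixed by \<open>\<sigma>\<close> enters the quadratic count as soon as
    it lies in \<open>S\<close>, so its \<open>\<epsilon>\<close> is moved into the linear
    weight.\<close>
  define w where "w e = exp (s + (if \<sigma> e = e then \<epsilon> else 0))" for e
  \<comment> \<open>The factor 3 comes from cubing \<open>exp (\<epsilon> * Q k S)\<close>.\<close>
  define b where "b = exp (3 * \<epsilon>) - 1"
  define Q where "Q k S = real (card {e \<in> C k. e \<in> S \<and> \<sigma> e \<in> S})" for k S
  define L where "L S = (\<Prod>e\<in>A. if e \<in> S then w e else 1)" for S :: "nat set set"
  have finC: "finite (C k)" for k using fin by (simp add: C_def)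
  have L0: "0 \<le> L S" for S by (auto simp: L_def w_def intro!: prod_nonneg)
  have b0: "0 \<le> b" and b1: "1 + b = exp (3 * \<epsilon>)" using \<epsilon> by (simp_all add: b_def)
  have pair: "measure_pmf.expectation (random_edges A p) (\<lambda>S. L S * exp (3 * \<epsilon> * Q k S)) \<le> exp ?B"
    for k
  proof -
    \<comment> \<open>A proper colouring sends each class outside itself, which is the hypothesis of
      \<open>expectation_disjoint_pairs\<close>.\<close>
    have imgC: "\<sigma> ` C k \<subseteq> A - C k"
    proof
      fix g assume "g \<in> \<sigma> ` C k"
      then obtain f where f: "f \<in> A" "\<sigma> f \<noteq> f" "c f = k" "g = \<sigma> f" by (auto simp: C_def)
      then show "g \<in> A - C k" using c(2)[of f] img by (auto simp: C_def)
    qed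
    have "measure_pmf.expectation (random_edges A p) (\<lambda>S. L S * exp (3 * \<epsilon> * Q k S)) =
      measure_pmf.expectation (random_edges A p)
      (\<lambda>S. (\<Prod>e\<in>A. if e \<in> S then w e else 1) *
           (\<Prod>e\<in>C k. if e \<in> S \<and> \<sigma> e \<in> S then 1 + b else 1))"
      unfolding L_def Q_def exp_card_eq_prod[OF finC] by (simp add: b1 cong: if_cong)
    also have "\<dots> \<le> exp ((\<Sum>e\<in>A. p * (w e - 1)) + (\<Sum>e\<in>C k. p\<^sup>2 * b * w e * w (\<sigma> e)))"
      using imgC s \<epsilon> p b0 inj
      by (intro expectation_disjoint_pairs fin) (auto simp: C_def w_def intro: inj_on_subset)
    also have "\<dots> \<le> exp ?B"
    proof -
      have "(\<Sum>e\<in>A. p * (w e - 1)) = (\<Sum>e\<in>A. p * (exp s - 1) +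
          (p * exp s * (exp \<epsilon> - 1)) * of_bool (\<sigma> e = e))"
        by (intro sum.cong) (auto simp: w_def exp_add algebra_simps)
      also have "\<dots> = real (card A) * (p * (exp s - 1))
        + real (card {e \<in> A. \<sigma> e = e}) * (p * exp s * (exp \<epsilon> - 1))"
        by (simp add: sum.distrib sum_distrib_left[symmetric] sum_of_bool_mem fin Int_def)
      finally have 1: "(\<Sum>e\<in>A. p * (w e - 1)) = real (card A) * (p * (exp s - 1))
        + real (card {e \<in> A. \<sigma> e = e}) * (p * exp s * (exp \<epsilon> - 1))" .
      have w_le: "w e \<le> exp (s + \<epsilon>)" for e using \<epsilon> by (simp add: w_def)
      have w0: "0 \<le> w e" for e by (simp add: w_def)
      \<comment> \<open>The pair terms will be of lower order, so each weight is replaced by the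
        largest one and then the class by all of \<open>A\<close>.\<close>
      have "(\<Sum>e\<in>C k. p\<^sup>2 * b * w e * w (\<sigma> e)) \<le> (\<Sum>e\<in>C k. p\<^sup>2 * b * exp (s + \<epsilon>) * exp (s + \<epsilon>))"
        using b0 by (intro sum_mono mult_mono w_le w0) (auto intro!: mult_nonneg_nonneg w0)
      also have "\<dots> \<le> (\<Sum>e\<in>A. p\<^sup>2 * b * exp (s + \<epsilon>) * exp (s + \<epsilon>))"
        using b0 fin by (intro sum_mono2) (auto simp: C_def)
      also have "\<dots> = real (card A) * (p\<^sup>2 * exp (2 * (s + \<epsilon>)) * (exp (3 * \<epsilon>) - 1))"
        by (simp add: b_def mult_ac flip: exp_add)
      finally show ?thesis using 1 by simp
    qed
    finally show ?thesis .
  qed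
  have bound: "exp (s * real (card {e \<in> A. e \<in> S}) + \<epsilon> * real (card {e \<in> A. e \<in> S \<and> \<sigma> e \<in> S}))
    \<le> (L S * exp (3 * \<epsilon> * Q 0 S) + L S * exp (3 * \<epsilon> * Q 1 S) + L S * exp (3 * \<epsilon> * Q 2 S)) / 3" for S
  proof -
    let ?F = "{e \<in> A. \<sigma> e = e \<and> e \<in> S}"
    let ?D = "\<lambda>k. {e \<in> C k. e \<in> S \<and> \<sigma> e \<in> S}"
    have "{e \<in> A. e \<in> S \<and> \<sigma> e \<in> S} = ?F \<union> (?D 0 \<union> (?D 1 \<union> ?D 2))"
      using c(1) by (auto simp: C_def)
    moreover have "finite ?F" "finite (?D k)" for k
      using fin finC by simp_all
    moreover have "?D 1 \<inter> ?D 2 = {}" "?D 0 \<inter> (?D 1 \<union> ?D 2) = {}" "?F \<inter> (?D 0 \<union> (?D 1 \<union> ?D 2)) = {}"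
      by (auto simp: C_def)
    ultimately have "card {e \<in> A. e \<in> S \<and> \<sigma> e \<in> S} = card ?F + (card (?D 0) + (card (?D 1) + card (?D 2)))"
      by (simp only: card_Un_disjoint finite_Un)
    then have "exp (s * real (card {e \<in> A. e \<in> S}) + \<epsilon> * real (card {e \<in> A. e \<in> S \<and> \<sigma> e \<in> S}))
      = (exp (s * real (card {e \<in> A. e \<in> S})) * exp (\<epsilon> * real (card ?F))) *
        (exp (\<epsilon> * Q 0 S) * exp (\<epsilon> * Q 1 S) * exp (\<epsilon> * Q 2 S))"
      by (simp add: exp_add[symmetric] Q_def algebra_simps)
    also have "exp (s * real (card {e \<in> A. e \<in> S})) * exp (\<epsilon> * real (card ?F)) = L S"
      unfolding L_def exp_card_eq_prod[OF fin] prod.distrib[symmetric] w_def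
      by (intro prod.cong) (auto simp: exp_add)
    also have "L S * (exp (\<epsilon> * Q 0 S) * exp (\<epsilon> * Q 1 S) * exp (\<epsilon> * Q 2 S)) \<le>
      L S * ((exp (\<epsilon> * Q 0 S) ^ 3 + exp (\<epsilon> * Q 1 S) ^ 3 + exp (\<epsilon> * Q 2 S) ^ 3) / 3)"
      by (intro mult_left_mono mult3_le_sum_cubes L0) auto
    also have "\<dots> = (L S * exp (3 * \<epsilon> * Q 0 S) + L S * exp (3 * \<epsilon> * Q 1 S) + L S * exp (3 * \<epsilon> * Q 2 S)) / 3"
      by (simp add: exp_of_nat_mult[symmetric] algebra_simps)
    finally show ?thesis .
  qed
  have int: "integrable (random_edges A p) f" for f :: "_ \<Rightarrow> real"
    by (intro integrable_measure_pmf_finite finite_set_pmf_random_edges fin)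
  have "?E \<le> measure_pmf.expectation (random_edges A p)
    (\<lambda>S. (L S * exp (3 * \<epsilon> * Q 0 S) + L S * exp (3 * \<epsilon> * Q 1 S) + L S * exp (3 * \<epsilon> * Q 2 S)) / 3)"
    by (intro expectation_mono_finite finite_set_pmf_random_edges fin bound)
  also have "\<dots> = (measure_pmf.expectation (random_edges A p) (\<lambda>S. L S * exp (3 * \<epsilon> * Q 0 S)) +
    measure_pmf.expectation (random_edges A p) (\<lambda>S. L S * exp (3 * \<epsilon> * Q 1 S)) +
    measure_pmf.expectation (random_edges A p) (\<lambda>S. L S * exp (3 * \<epsilon> * Q 2 S))) / 3"
    by (simp add: int)
  also have "\<dots> \<le> exp ?B"
    using pair[of 0] pair[of 1] pair[of 2] by simp
  finally show ?thesis .
qed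

section \<open>Averaging over the correlated graph pair\<close>

lemma prod_le_exp_sum:
  fixes h g :: "'a \<Rightarrow> real"
  assumes "\<And>x. x \<in> A \<Longrightarrow> 0 \<le> h x" "\<And>x. x \<in> A \<Longrightarrow> h x \<le> 1 + g x"
  shows "(\<Prod>x\<in>A. h x) \<le> exp (\<Sum>x\<in>A. g x)"
proof (cases "finite A")
  case True
  have "(\<Prod>x\<in>A. h x) \<le> (\<Prod>x\<in>A. exp (g x))"
    using assms by (intro prod_mono) (meson order_trans exp_ge_add_one_self)
  then show ?thesis
    by (simp add: exp_sum True)
qed simp

lemma expectation_pair_pmf_mult:
  fixes f :: "'a \<Rightarrow> real" and g :: "'b \<Rightarrow> real"
  assumes "finite (set_pmf M)" "finite (set_pmf N)"
  shows "measure_pmf.expectation (pair_pmf M N) (\<lambda>(x, y). f x * g y) =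
    measure_pmf.expectation M f * measure_pmf.expectation N g"
  by (simp add: expectation_pair_pmf_finite[OF assms])

text \<open>With \<open>H\<close> fixed, a common edge has the factor \<open>1 + p * (a * x\<^sub>1
  + a * x\<^sub>2 + a\<^sup>2 * x\<^sub>1 * x\<^sub>2)\<close>, whereas a private edge contributes
  \<open>1 + p * a * x\<^sub>1\<close> and \<open>1 + p * a * x\<^sub>2\<close> separately; here
  \<open>x\<^sub>1\<close> and \<open>x\<^sub>2\<close> indicate that its images lie in
  \<open>H\<close>. The exponent obtained is that of the case in which all edges are common.\<close>

lemma expectation_exp_correlated:
  fixes g\<^sub>1 g\<^sub>2 :: "nat set \<Rightarrow> nat set" and H :: graph and n :: nat
  assumes p: "0 \<le> p" "p \<le> 1" and \<theta>: "0 \<le> \<theta>"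
  defines "E \<equiv> set (edge_list n)" and "a \<equiv> exp \<theta> - 1"
  shows "measure_pmf.expectation (correlated_instance n p \<alpha>)
      (\<lambda>(G\<^sub>1, G\<^sub>2). exp (\<theta> * (real (card {e \<in> E. e \<in> G\<^sub>1 \<and> g\<^sub>1 e \<in> H}) +
                              real (card {e \<in> E. e \<in> G\<^sub>2 \<and> g\<^sub>2 e \<in> H}))))
    \<le> exp (p * a * (real (card {e \<in> E. g\<^sub>1 e \<in> H}) + real (card {e \<in> E. g\<^sub>2 e \<in> H})) +
           p * a\<^sup>2 * real (card {e \<in> E. g\<^sub>1 e \<in> H \<and> g\<^sub>2 e \<in> H}))"
proof -
  define m where "m = nat \<lfloor>\<alpha> * real (n choose 2)\<rfloor>"
  define K P where "K = set (take m (edge_list n))" and "P = set (drop m (edge_list n))"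
  have E: "E = K \<union> P"
    unfolding E_def K_def P_def by (metis append_take_drop_id set_append)
  have KP: "K \<inter> P = {}"
    unfolding K_def P_def by (rule set_take_disj_set_drop_if_distinct) (auto simp: distinct_edge_list)
  have fin: "finite K" "finite P" by (auto simp: K_def P_def)
  have a0: "0 \<le> a" using \<theta> by (simp add: a_def)
  define x\<^sub>1 x\<^sub>2 :: "nat set \<Rightarrow> real"
    where "x\<^sub>1 e = of_bool (g\<^sub>1 e \<in> H)" and "x\<^sub>2 e = of_bool (g\<^sub>2 e \<in> H)" for e
  \<comment> \<open>\<open>X\<close> collects the common edges, which count in both overlaps at
    once, and \<open>Y\<close> the private edges of one graph.\<close>
  define X where "X C = (\<Prod>e\<in>K. if e \<in> C then exp (\<theta> * (x\<^sub>1 e + x\<^sub>2 e)) else 1)" for C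
  define Y where "Y x A = (\<Prod>e\<in>P. if e \<in> A then exp (\<theta> * x e) else 1)" for x A
  have single: "exp (\<theta> * real (card {e \<in> E. e \<in> C \<union> A \<and> g e \<in> H})) =
      (\<Prod>e\<in>K. if e \<in> C then exp (\<theta> * of_bool (g e \<in> H)) else 1) * Y (\<lambda>e. of_bool (g e \<in> H)) A"
    if "C \<subseteq> K" "A \<subseteq> P" for C A and g :: "nat set \<Rightarrow> nat set"
  proof -
    have "exp (\<theta> * real (card {e \<in> E. e \<in> C \<union> A \<and> g e \<in> H})) =
      (\<Prod>e\<in>K. if e \<in> C \<union> A \<and> g e \<in> H then exp \<theta> else 1) *
      (\<Prod>e\<in>P. if e \<in> C \<union> A \<and> g e \<in> H then exp \<theta> else 1)"
      unfolding E using fin KP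
      by (subst exp_card_eq_prod) (simp_all del: Un_iff add: prod.union_disjoint)
    also have "(\<Prod>e\<in>K. if e \<in> C \<union> A \<and> g e \<in> H then exp \<theta> else 1) =
      (\<Prod>e\<in>K. if e \<in> C then exp (\<theta> * of_bool (g e \<in> H)) else 1)"
      using that KP by (intro prod.cong) auto
    also have "(\<Prod>e\<in>P. if e \<in> C \<union> A \<and> g e \<in> H then exp \<theta> else 1) = Y (\<lambda>e. of_bool (g e \<in> H)) A"
      unfolding Y_def using that KP by (intro prod.cong) auto
    finally show ?thesis .
  qed
  let ?f = "\<lambda>(G\<^sub>1, G\<^sub>2). exp (\<theta> * (real (card {e \<in> E. e \<in> G\<^sub>1 \<and> g\<^sub>1 e \<in> H}) +
                              real (card {e \<in> E. e \<in> G\<^sub>2 \<and> g\<^sub>2 e \<in> H})))"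
  have factor: "?f (C \<union> A\<^sub>1, C \<union> A\<^sub>2) = X C * (Y x\<^sub>1 A\<^sub>1 * Y x\<^sub>2 A\<^sub>2)"
    if "C \<subseteq> K" "A\<^sub>1 \<subseteq> P" "A\<^sub>2 \<subseteq> P" for C A\<^sub>1 A\<^sub>2
  proof -
    have "X C = (\<Prod>e\<in>K. if e \<in> C then exp (\<theta> * x\<^sub>1 e) else 1) * (\<Prod>e\<in>K. if e \<in> C then exp (\<theta> * x\<^sub>2 e) else 1)"
      unfolding X_def prod.distrib[symmetric] by (intro prod.cong) (auto simp: distrib_left exp_add)
    then show ?thesis
      using single[of C A\<^sub>1 g\<^sub>1] single[of C A\<^sub>2 g\<^sub>2] that
      by (simp add: distrib_left exp_add x\<^sub>1_def[abs_def] x\<^sub>2_def[abs_def] cong: if_cong)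
  qed
  let ?M = "pair_pmf (random_edges K p) (pair_pmf (random_edges P p) (random_edges P p))"
  have "measure_pmf.expectation (correlated_instance n p \<alpha>) ?f =
    measure_pmf.expectation ?M (\<lambda>(C, A\<^sub>1, A\<^sub>2). ?f (C \<union> A\<^sub>1, C \<union> A\<^sub>2))"
    by (simp add: correlated_instance_def Let_def m_def[symmetric] K_def[symmetric] P_def[symmetric]
        case_prod_unfold)
  also have "\<dots> = measure_pmf.expectation ?M (\<lambda>(C, D). X C * (\<lambda>(A\<^sub>1, A\<^sub>2). Y x\<^sub>1 A\<^sub>1 * Y x\<^sub>2 A\<^sub>2) D)"
  proof (intro integral_cong_AE AE_pmfI)
    fix z assume "z \<in> set_pmf ?M"
    then obtain C A\<^sub>1 A\<^sub>2 where "z = (C, A\<^sub>1, A\<^sub>2)" "C \<subseteq> K" "A\<^sub>1 \<subseteq> P" "A\<^sub>2 \<subseteq> P"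
      using set_pmf_random_edges by (cases z) fastforce
    then show "(case z of (C, A\<^sub>1, A\<^sub>2) \<Rightarrow> ?f (C \<union> A\<^sub>1, C \<union> A\<^sub>2)) =
      (case z of (C, D) \<Rightarrow> X C * (\<lambda>(A\<^sub>1, A\<^sub>2). Y x\<^sub>1 A\<^sub>1 * Y x\<^sub>2 A\<^sub>2) D)"
      using factor by simp
  qed auto
  also have "\<dots> = measure_pmf.expectation (random_edges K p) X *
      (measure_pmf.expectation (random_edges P p) (Y x\<^sub>1) *
       measure_pmf.expectation (random_edges P p) (Y x\<^sub>2))"
    using fin finite_set_pmf_random_edges
    by (subst expectation_pair_pmf_mult, simp, simp, subst expectation_pair_pmf_mult) simp_all
  also have "\<dots> \<le> exp (\<Sum>e\<in>K. p * (a * x\<^sub>1 e + a * x\<^sub>2 e + a\<^sup>2 * (x\<^sub>1 e * x\<^sub>2 e))) *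
      (exp (\<Sum>e\<in>P. p * (a * x\<^sub>1 e)) * exp (\<Sum>e\<in>P. p * (a * x\<^sub>2 e)))"
  proof -
    have nn: "0 \<le> p * exp t + (1 - p)" for t
      using p by (intro add_nonneg_nonneg) auto
    have "measure_pmf.expectation (random_edges K p)
        (\<lambda>C. \<Prod>e\<in>K. (\<lambda>e b. if b then exp (\<theta> * (x\<^sub>1 e + x\<^sub>2 e)) else 1) e (e \<in> C))
      \<le> exp (\<Sum>e\<in>K. p * (a * x\<^sub>1 e + a * x\<^sub>2 e + a\<^sup>2 * (x\<^sub>1 e * x\<^sub>2 e)))"
    proof (subst expectation_random_edges_prod[OF fin(1) p])
      show "(\<Prod>e\<in>K. p * (if True then exp (\<theta> * (x\<^sub>1 e + x\<^sub>2 e)) else 1) +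
          (1 - p) * (if False then exp (\<theta> * (x\<^sub>1 e + x\<^sub>2 e)) else 1))
        \<le> exp (\<Sum>e\<in>K. p * (a * x\<^sub>1 e + a * x\<^sub>2 e + a\<^sup>2 * (x\<^sub>1 e * x\<^sub>2 e)))"
      proof (intro prod_le_exp_sum)
        fix e
        \<comment> \<open>An identity, since both indicators are 0 or 1; the product term is the
          effect of sharing the edge.\<close>
        have "exp (\<theta> * (x\<^sub>1 e + x\<^sub>2 e)) = 1 + (a * x\<^sub>1 e + a * x\<^sub>2 e + a\<^sup>2 * (x\<^sub>1 e * x\<^sub>2 e))"
          by (simp add: x\<^sub>1_def x\<^sub>2_def a_def power2_eq_square algebra_simps flip: exp_add)
        then show "p * (if True then exp (\<theta> * (x\<^sub>1 e + x\<^sub>2 e)) else 1) +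
            (1 - p) * (if False then exp (\<theta> * (x\<^sub>1 e + x\<^sub>2 e)) else 1) \<le>
          1 + p * (a * x\<^sub>1 e + a * x\<^sub>2 e + a\<^sup>2 * (x\<^sub>1 e * x\<^sub>2 e))"
          by (simp add: distrib_left)
      qed (use nn in simp)
    qed simp
    moreover have "measure_pmf.expectation (random_edges P p)
        (\<lambda>A. \<Prod>e\<in>P. (\<lambda>e b. if b then exp (\<theta> * x e) else 1) e (e \<in> A))
      \<le> exp (\<Sum>e\<in>P. p * (a * x e))" if "x \<in> {x\<^sub>1, x\<^sub>2}" for x
    proof (subst expectation_random_edges_prod[OF fin(2) p])
      show "(\<Prod>e\<in>P. p * (if True then exp (\<theta> * x e) else 1) +
          (1 - p) * (if False then exp (\<theta> * x e) else 1)) \<le> exp (\<Sum>e\<in>P. p * (a * x e))"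
      proof (intro prod_le_exp_sum)
        fix e
        have "exp (\<theta> * x e) = 1 + a * x e"
          using that by (auto simp: x\<^sub>1_def x\<^sub>2_def a_def)
        then show "p * (if True then exp (\<theta> * x e) else 1) +
            (1 - p) * (if False then exp (\<theta> * x e) else 1) \<le> 1 + p * (a * x e)"
          by (simp add: distrib_left)
      qed (use nn in simp)
    qed simp
    ultimately show ?thesis
      unfolding X_def[abs_def] Y_def[abs_def]
      by (intro mult_mono Bochner_Integration.integral_nonneg mult_nonneg_nonneg prod_nonneg) auto
  qed
  \<comment> \<open>Adding the nonnegative product term for the private edges too removes the
    dependence on \<open>\<alpha>\<close>.\<close>
  also have "\<dots> \<le> exp (\<Sum>e\<in>E. p * (a * x\<^sub>1 e + a * x\<^sub>2 e + a\<^sup>2 * (x\<^sub>1 e * x\<^sub>2 e)))"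
  proof -
    have "(\<Sum>e\<in>P. p * (a * x\<^sub>1 e)) + (\<Sum>e\<in>P. p * (a * x\<^sub>2 e)) \<le>
      (\<Sum>e\<in>P. p * (a * x\<^sub>1 e + a * x\<^sub>2 e + a\<^sup>2 * (x\<^sub>1 e * x\<^sub>2 e)))"
      unfolding sum.distrib[symmetric] using p
      by (intro sum_mono) (simp add: x\<^sub>1_def x\<^sub>2_def algebra_simps)
    then show ?thesis
      using fin KP by (simp add: E sum.union_disjoint flip: exp_add)
  qed
  also have "(\<Sum>e\<in>E. p * (a * x\<^sub>1 e + a * x\<^sub>2 e + a\<^sup>2 * (x\<^sub>1 e * x\<^sub>2 e))) =
      p * a * ((\<Sum>e\<in>E. of_bool (g\<^sub>1 e \<in> H)) + (\<Sum>e\<in>E. of_bool (g\<^sub>2 e \<in> H))) +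
      p * a\<^sup>2 * (\<Sum>e\<in>E. of_bool (g\<^sub>1 e \<in> H \<and> g\<^sub>2 e \<in> H))"
    unfolding x\<^sub>1_def x\<^sub>2_def of_bool_conj[symmetric]
    unfolding sum.distrib[symmetric] sum_distrib_left
    by (intro sum.cong) (auto simp: algebra_simps)
  finally show ?thesis
    using fin by (simp only: sum_of_bool_mem finite_Un E)
qed

section \<open>Edge overlaps as edge counts, and their joint exponential moment\<close>

lemma edge_overlap_eq_card:
  "edge_overlap n G H \<pi> = real (card {e \<in> set (edge_list n). e \<in> G \<and> \<pi> ` e \<in> H})"
proof -
  have bij: "bij_betw (\<lambda>(j, i). {i, j}) (SIGMA j:{1..n}. {1..<j}) (set (edge_list n))"
    unfolding bij_betw_def set_edge_list
    by (force simp: inj_on_def doubleton_eq_iff image_iff)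
  have "edge_overlap n G H \<pi> =
      (\<Sum>(j, i)\<in>(SIGMA j:{1..n}. {1..<j}). of_bool ({i, j} \<in> G \<and> \<pi> ` {i, j} \<in> H))"
    unfolding edge_overlap_def adj_def of_bool_conj[symmetric] by (subst sum.Sigma) auto
  also have "\<dots> = (\<Sum>z\<in>(SIGMA j:{1..n}. {1..<j}).
      (\<lambda>e. of_bool (e \<in> G \<and> \<pi> ` e \<in> H)) ((\<lambda>(j, i). {i, j}) z))"
    by (intro sum.cong) auto
  also have "\<dots> = (\<Sum>e\<in>set (edge_list n). of_bool (e \<in> G \<and> \<pi> ` e \<in> H))"
    by (rule sum.reindex_bij_betw[OF bij])
  finally show ?thesis by (simp only: sum_of_bool_mem[OF List.finite_set])
qed

text \<open>Without an order of the endpoints, the set of edges is visibly invariant under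
  permutations of the vertices.\<close>

lemma set_edge_list_eq: "set (edge_list n) = {e. e \<subseteq> {1..n} \<and> card e = 2}"
proof (intro set_eqI iffI)
  fix e assume "e \<in> {e. e \<subseteq> {1..n} \<and> card e = 2}"
  then obtain i j where "e = {i, j}" "i \<noteq> j" "i \<in> {1..n}" "j \<in> {1..n}"
    by (auto simp: card_2_iff)
  then show "e \<in> set (edge_list n)"
    unfolding set_edge_list by (cases i j rule: linorder_cases) (auto simp: insert_commute)
qed (auto simp: set_edge_list)

lemma card_set_edge_list: "card (set (edge_list n)) = n choose 2"
  by (simp add: distinct_card distinct_edge_list length_edge_list)

lemma bij_betw_image_edge_list:
  assumes "\<pi> permutes {1..n}"
  shows "bij_betw ((`) \<pi>) (set (edge_list n)) (set (edge_list n))"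
proof (rule bij_betwI[where g = "(`) (inv \<pi>)"])
  have "\<rho> ` e \<in> set (edge_list n)" if "\<rho> permutes {1..n}" "e \<in> set (edge_list n)" for \<rho> e
    using that card_image[OF permutes_inj_on[OF that(1)], of e] permutes_in_image[OF that(1)]
    by (auto simp: set_edge_list_eq)
  then show "(`) \<pi> \<in> set (edge_list n) \<rightarrow> set (edge_list n)"
    "(`) (inv \<pi>) \<in> set (edge_list n) \<rightarrow> set (edge_list n)"
    using assms permutes_inv by blast+
qed (simp_all add: image_image permutes_inverses[OF assms])

lemma card_Collect_bij_betw:
  assumes "bij_betw g A B"
  shows "card {x \<in> A. P (g x)} = card {y \<in> B. P y}"
  by (rule bij_betw_same_card[of g]) (use assms in \<open>auto simp: bij_betw_def inj_on_def image_iff\<close>)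

lemma finite_set_pmf_correlated_instance: "finite (set_pmf (correlated_instance n p \<alpha>))"
  by (simp add: correlated_instance_def Let_def finite_set_pmf_random_edges)

text \<open>Averaging over the graph pair for fixed \<open>H\<close> leaves the exponential of a
  linear and a quadratic edge count of \<open>H\<close>; \<open>expectation_exp_quadratic\<close>
  then applies with \<open>2 * p * a\<close> for its \<open>s\<close> and
  \<open>p * a\<^sup>2\<close> for its \<open>\<epsilon>\<close>.\<close>

lemma expectation_exp_edge_overlaps:
  fixes n :: nat and p \<theta> :: real
  assumes p: "0 \<le> p" "p \<le> 1" and \<theta>: "0 \<le> \<theta>"
    and \<pi>\<^sub>1: "\<pi>\<^sub>1 permutes {1..n}" and \<pi>\<^sub>2: "\<pi>\<^sub>2 permutes {1..n}"
  defines "N \<equiv> real (n choose 2)" and "a \<equiv> exp \<theta> - 1"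
    and "F \<equiv> real (card {e \<in> set (edge_list n). \<pi>\<^sub>1 ` e = \<pi>\<^sub>2 ` e})"
  shows "measure_pmf.expectation (pair_pmf (correlated_instance n p \<alpha>) (erdos_renyi n p))
      (\<lambda>((G\<^sub>1, G\<^sub>2), H). exp (\<theta> * (edge_overlap n G\<^sub>1 H \<pi>\<^sub>1 + edge_overlap n G\<^sub>2 H \<pi>\<^sub>2)))
    \<le> exp (N * (p * (exp (2 * p * a) - 1)) + F * (p * exp (2 * p * a) * (exp (p * a\<^sup>2) - 1)) +
        N * (p\<^sup>2 * exp (2 * (2 * p * a + p * a\<^sup>2)) * (exp (3 * (p * a\<^sup>2)) - 1)))"
proof -
  define E where "E = set (edge_list n)"
  have finE: "finite E" by (simp add: E_def)
  have a0: "0 \<le> a" using \<theta> by (simp add: a_def)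
  note b1 = bij_betw_image_edge_list[OF \<pi>\<^sub>1, folded E_def]
  note b2 = bij_betw_image_edge_list[OF \<pi>\<^sub>2, folded E_def]
  \<comment> \<open>Substituting \<open>f\<close> for the image of an edge under the first
    permutation makes its image under the second one \<open>\<sigma> f\<close>, so a single map on
    edges describes both.\<close>
  define \<sigma> where "\<sigma> f = \<pi>\<^sub>2 ` (inv \<pi>\<^sub>1 ` f)" for f
  have \<sigma>1: "\<sigma> (\<pi>\<^sub>1 ` e) = \<pi>\<^sub>2 ` e" for e
    by (simp add: \<sigma>_def image_image permutes_inverses[OF \<pi>\<^sub>1])
  have \<sigma>: "bij_betw \<sigma> E E"
    using bij_betw_trans[OF bij_betw_image_edge_list[OF permutes_inv[OF \<pi>\<^sub>1], folded E_def] b2]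
    by (simp add: \<sigma>_def[abs_def] o_def)
  have F: "F = real (card {f \<in> E. \<sigma> f = f})"
    using card_Collect_bij_betw[OF b1, of "\<lambda>f. \<sigma> f = f"]
    by (simp add: F_def E_def[symmetric] \<sigma>1 eq_commute)
  have inner: "measure_pmf.expectation (correlated_instance n p \<alpha>)
      (\<lambda>(G\<^sub>1, G\<^sub>2). exp (\<theta> * (edge_overlap n G\<^sub>1 H \<pi>\<^sub>1 + edge_overlap n G\<^sub>2 H \<pi>\<^sub>2)))
    \<le> exp (2 * p * a * real (card {f \<in> E. f \<in> H}) +
           p * a\<^sup>2 * real (card {f \<in> E. f \<in> H \<and> \<sigma> f \<in> H}))" for H
    using expectation_exp_correlated[OF p \<theta>, of n \<alpha> "(`) \<pi>\<^sub>1" H "(`) \<pi>\<^sub>2"]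
      card_Collect_bij_betw[OF b1, of "\<lambda>f. f \<in> H"] card_Collect_bij_betw[OF b2, of "\<lambda>f. f \<in> H"]
      card_Collect_bij_betw[OF b1, of "\<lambda>f. f \<in> H \<and> \<sigma> f \<in> H"]
    by (simp add: edge_overlap_eq_card E_def[symmetric] a_def[symmetric] \<sigma>1 mult_ac)
  \<comment> \<open>\<open>H\<close> is moved to the outer expectation, so that the bound for fixed
    \<open>H\<close> applies inside.\<close>
  have "measure_pmf.expectation (pair_pmf (correlated_instance n p \<alpha>) (erdos_renyi n p))
      (\<lambda>((G\<^sub>1, G\<^sub>2), H). exp (\<theta> * (edge_overlap n G\<^sub>1 H \<pi>\<^sub>1 + edge_overlap n G\<^sub>2 H \<pi>\<^sub>2))) =
    measure_pmf.expectation (random_edges E p) (\<lambda>H.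
      measure_pmf.expectation (correlated_instance n p \<alpha>)
      (\<lambda>(G\<^sub>1, G\<^sub>2). exp (\<theta> * (edge_overlap n G\<^sub>1 H \<pi>\<^sub>1 + edge_overlap n G\<^sub>2 H \<pi>\<^sub>2))))"
    by (subst pair_commute_pmf) (simp add: expectation_pair_pmf_finite erdos_renyi_def E_def
        finite_set_pmf_random_edges finite_set_pmf_correlated_instance case_prod_unfold)
  also have "\<dots> \<le> measure_pmf.expectation (random_edges E p) (\<lambda>H.
      exp (2 * p * a * real (card {f \<in> E. f \<in> H}) +
           p * a\<^sup>2 * real (card {f \<in> E. f \<in> H \<and> \<sigma> f \<in> H})))"
    by (intro expectation_mono_finite inner finite_set_pmf_random_edges finE)
  also have "\<dots> \<le> exp (real (card E) * (p * (exp (2 * p * a) - 1)) +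
        real (card {f \<in> E. \<sigma> f = f}) * (p * exp (2 * p * a) * (exp (p * a\<^sup>2) - 1)) +
        real (card E) * (p\<^sup>2 * exp (2 * (2 * p * a + p * a\<^sup>2)) * (exp (3 * (p * a\<^sup>2)) - 1)))"
    using p a0 by (intro expectation_exp_quadratic finE \<sigma>) auto
  finally show ?thesis
    by (simp add: F N_def E_def card_set_edge_list)
qed

section \<open>Counting fixed edges and pairs of permutations\<close>

text \<open>Equal images mean either that the permutations agree at both endpoints or that they
  exchange the endpoints. The first case gives the quadratic term; in the second one endpoint
  determines the other, so there are at most \<open>n\<close> such edges.\<close>

lemma card_edges_same_image_le:
  assumes \<pi>\<^sub>1: "\<pi>\<^sub>1 permutes {1..n}" and \<pi>\<^sub>2: "\<pi>\<^sub>2 permutes {1..n}"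
  shows "real (card {e \<in> set (edge_list n). \<pi>\<^sub>1 ` e = \<pi>\<^sub>2 ` e})
    \<le> (real (perm_overlap n \<pi>\<^sub>1 \<pi>\<^sub>2))\<^sup>2 / 2 + real n"
proof -
  define D where "D = {i \<in> {1..n}. \<pi>\<^sub>1 i = \<pi>\<^sub>2 i}"
  have finD: "finite D" by (simp add: D_def)
  \<comment> \<open>All edges with exchanged endpoints lie in \<open>T\<close>, which also contains
    singletons from the points of agreement.\<close>
  define T where "T = (\<lambda>i. {i, inv \<pi>\<^sub>2 (\<pi>\<^sub>1 i)}) ` {1..n}"
  have "{e \<in> set (edge_list n). \<pi>\<^sub>1 ` e = \<pi>\<^sub>2 ` e} \<subseteq> {e. e \<subseteq> D \<and> card e = 2} \<union> T"
  proof clarify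
    fix e assume "e \<in> set (edge_list n)" and eq: "\<pi>\<^sub>1 ` e = \<pi>\<^sub>2 ` e"
      and "e \<notin> T"
    then obtain i j where e: "e = {i, j}" "i \<noteq> j" "i \<in> {1..n}" "j \<in> {1..n}"
      by (auto simp: set_edge_list_eq card_2_iff)
    have "\<pi>\<^sub>1 i = \<pi>\<^sub>2 i \<and> \<pi>\<^sub>1 j = \<pi>\<^sub>2 j \<or> \<pi>\<^sub>1 i = \<pi>\<^sub>2 j \<and> \<pi>\<^sub>1 j = \<pi>\<^sub>2 i"
      using eq by (auto simp: e doubleton_eq_iff)
    moreover have "\<pi>\<^sub>1 i \<noteq> \<pi>\<^sub>2 j"
    proof
      assume "\<pi>\<^sub>1 i = \<pi>\<^sub>2 j"
      then have "e = {i, inv \<pi>\<^sub>2 (\<pi>\<^sub>1 i)}"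
        by (simp add: e permutes_inverses[OF \<pi>\<^sub>2])
      then show False using \<open>e \<notin> T\<close> e by (auto simp: T_def)
    qed
    ultimately show "e \<subseteq> D \<and> card e = 2"
      using e by (simp add: D_def)
  qed
  then have "card {e \<in> set (edge_list n). \<pi>\<^sub>1 ` e = \<pi>\<^sub>2 ` e} \<le> card ({e. e \<subseteq> D \<and> card e = 2} \<union> T)"
    using finD by (intro card_mono) (auto simp: T_def)
  also have "\<dots> \<le> card {e. e \<subseteq> D \<and> card e = 2} + card T"
    by (rule card_Un_le)
  also have "\<dots> \<le> (card D choose 2) + n"
    using card_image_le[of "{1..n}" "\<lambda>i. {i, inv \<pi>\<^sub>2 (\<pi>\<^sub>1 i)}"] by (simp add: n_subsets finD T_def)
  finally have "real (card {e \<in> set (edge_list n). \<pi>\<^sub>1 ` e = \<pi>\<^sub>2 ` e}) \<le> real (card D choose 2) + real n"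
    by linarith
  moreover have "real (card D choose 2) \<le> (real (card D))\<^sup>2 / 2"
  proof -
    have "2 * (card D choose 2) \<le> card D * card D"
      by (simp add: choose_two diff_mult_distrib2)
    then show ?thesis
      by (simp add: power2_eq_square flip: of_nat_mult)
  qed
  ultimately show ?thesis by (simp add: perm_overlap_def D_def)
qed

text \<open>Choosing \<open>m\<close> points of agreement and permuting the rest gives at most
  \<open>(n choose m) * fact (n - m) = fact n / fact m\<close> permutations.\<close>

lemma card_perm_overlap_le:
  assumes \<pi>\<^sub>1: "\<pi>\<^sub>1 permutes {1..n}" and m: "m \<le> n"
  shows "card {\<pi>\<^sub>2. \<pi>\<^sub>2 permutes {1..n} \<and> perm_overlap n \<pi>\<^sub>1 \<pi>\<^sub>2 = m} \<le> n ^ (n - m)"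
proof -
  let ?I = "{S. S \<subseteq> {1..n} \<and> card S = m}"
  let ?A = "\<lambda>S. {\<pi>\<^sub>2. \<pi>\<^sub>2 permutes {1..n} \<and> (\<forall>i\<in>S. \<pi>\<^sub>1 i = \<pi>\<^sub>2 i)}"
  have fin: "finite (?A S)" for S
    by (rule finite_subset[OF _ finite_permutations[of "{1..n}"]]) auto
  have A: "card (?A S) \<le> fact (n - m)" if S: "S \<subseteq> {1..n}" "card S = m" for S
  proof -
    \<comment> \<open>Composition with the inverse of the first permutation turns agreement on
      \<open>S\<close> into fixing \<open>S\<close> pointwise.\<close>
    have "card (?A S) \<le> card {\<rho>. \<rho> permutes ({1..n} - S)}"
    proof (rule card_inj_on_le[where f = "\<lambda>\<pi>\<^sub>2. inv \<pi>\<^sub>1 \<circ> \<pi>\<^sub>2"])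
      show "inj_on (\<lambda>\<pi>\<^sub>2. inv \<pi>\<^sub>1 \<circ> \<pi>\<^sub>2) (?A S)"
        using permutes_inv[OF \<pi>\<^sub>1, THEN permutes_inj] by (auto intro!: inj_onI dest: fun.inj_map[THEN injD])
      show "(\<lambda>\<pi>\<^sub>2. inv \<pi>\<^sub>1 \<circ> \<pi>\<^sub>2) ` ?A S \<subseteq> {\<rho>. \<rho> permutes ({1..n} - S)}"
      proof clarify
        fix \<pi>\<^sub>2 assume "\<pi>\<^sub>2 permutes {1..n}" and eq: "\<forall>i\<in>S. \<pi>\<^sub>1 i = \<pi>\<^sub>2 i"
        then have "inv \<pi>\<^sub>1 \<circ> \<pi>\<^sub>2 permutes {1..n}"
          by (intro permutes_compose permutes_inv \<pi>\<^sub>1)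
        moreover have "(inv \<pi>\<^sub>1 \<circ> \<pi>\<^sub>2) x = x" if "x \<in> {1..n} - ({1..n} - S)" for x
          using eq[rule_format, of x, symmetric] that by (simp add: permutes_inverses[OF \<pi>\<^sub>1])
        ultimately show "inv \<pi>\<^sub>1 \<circ> \<pi>\<^sub>2 permutes {1..n} - S"
          by (rule permutes_superset) auto
      qed
    qed (auto intro: finite_permutations)
    also have "\<dots> = fact (n - m)"
      using S by (intro card_permutations) (auto simp: card_Diff_subset finite_subset)
    finally show ?thesis .
  qed
  have "card {\<pi>\<^sub>2. \<pi>\<^sub>2 permutes {1..n} \<and> perm_overlap n \<pi>\<^sub>1 \<pi>\<^sub>2 = m} \<le> card (\<Union>S\<in>?I. ?A S)"
  proof (rule card_mono)
    show "{\<pi>\<^sub>2. \<pi>\<^sub>2 permutes {1..n} \<and> perm_overlap n \<pi>\<^sub>1 \<pi>\<^sub>2 = m} \<subseteq> (\<Union>S\<in>?I. ?A S)"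
    proof clarify
      fix \<pi>\<^sub>2 assume "\<pi>\<^sub>2 permutes {1..n}" "m = perm_overlap n \<pi>\<^sub>1 \<pi>\<^sub>2"
      then show "\<pi>\<^sub>2 \<in> (\<Union>S\<in>{S. S \<subseteq> {1..n} \<and> card S = perm_overlap n \<pi>\<^sub>1 \<pi>\<^sub>2}. ?A S)"
        by (intro UN_I[of "{i \<in> {1..n}. \<pi>\<^sub>1 i = \<pi>\<^sub>2 i}"]) (auto simp: perm_overlap_def)
    qed
  qed (use fin in auto)
  also have "\<dots> \<le> (\<Sum>S\<in>?I. card (?A S))"
    by (rule card_UN_le) simp
  also have "\<dots> \<le> (\<Sum>S\<in>?I. fact (n - m))"
    by (rule sum_mono) (use A in auto)
  also have "\<dots> = (n choose m) * fact (n - m)"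
    by (simp add: n_subsets)
  also have "\<dots> = fact n div fact m"
    using binomial_fact_lemma[OF m] by (metis fact_nonzero mult.assoc mult.commute nonzero_mult_div_cancel_left)
  also have "\<dots> \<le> n ^ (n - m)"
    using fact_div_fact_le_pow[of "n - m" n] m by simp
  finally show ?thesis .
qed

text \<open>For an overlap \<open>m\<close> there are at most \<open>n ^ n * n ^ (n - m)\<close>
  pairs; the factor \<open>n + 1\<close> accounts for the possible values of
  \<open>m\<close>.\<close>

lemma card_perm_pairs_le:
  assumes n: "1 \<le> n"
  shows "real (card {(\<pi>\<^sub>1, \<pi>\<^sub>2). \<pi>\<^sub>1 permutes {1..n} \<and> \<pi>\<^sub>2 permutes {1..n} \<and> r < real (perm_overlap n \<pi>\<^sub>1 \<pi>\<^sub>2)})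
    \<le> (real n + 1) * exp ((2 * real n - r) * ln (real n))"
proof -
  let ?P = "{\<pi>. \<pi> permutes {1..n}}"
  let ?M = "{m. m \<le> n \<and> r < real m}"
  let ?B = "\<lambda>\<pi>\<^sub>1 m. {\<pi>\<^sub>2. \<pi>\<^sub>2 permutes {1..n} \<and> perm_overlap n \<pi>\<^sub>1 \<pi>\<^sub>2 = m}"
  have fin: "finite ?P" by (simp add: finite_permutations)
  have finB: "finite (?B \<pi>\<^sub>1 m)" for \<pi>\<^sub>1 m
    by (rule finite_subset[OF _ fin]) auto
  have le_n: "perm_overlap n \<pi>\<^sub>1 \<pi>\<^sub>2 \<le> n" for \<pi>\<^sub>1 \<pi>\<^sub>2
    using card_mono[of "{1..n}" "{i \<in> {1..n}. \<pi>\<^sub>1 i = \<pi>\<^sub>2 i}"] by (simp add: perm_overlap_def subset_iff)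
  have "{(\<pi>\<^sub>1, \<pi>\<^sub>2). \<pi>\<^sub>1 permutes {1..n} \<and> \<pi>\<^sub>2 permutes {1..n} \<and> r < real (perm_overlap n \<pi>\<^sub>1 \<pi>\<^sub>2)}
      = (SIGMA \<pi>\<^sub>1:?P. \<Union>m\<in>?M. ?B \<pi>\<^sub>1 m)"
    using le_n by auto
  then have "card {(\<pi>\<^sub>1, \<pi>\<^sub>2). \<pi>\<^sub>1 permutes {1..n} \<and> \<pi>\<^sub>2 permutes {1..n} \<and> r < real (perm_overlap n \<pi>\<^sub>1 \<pi>\<^sub>2)}
      = (\<Sum>\<pi>\<^sub>1\<in>?P. card (\<Union>m\<in>?M. ?B \<pi>\<^sub>1 m))"
    using fin finB by (simp add: card_SigmaI)
  also have "\<dots> \<le> (\<Sum>\<pi>\<^sub>1\<in>?P. \<Sum>m\<in>?M. card (?B \<pi>\<^sub>1 m))"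
    by (intro sum_mono card_UN_le) simp
  also have "\<dots> \<le> (\<Sum>\<pi>\<^sub>1\<in>?P. \<Sum>m\<in>?M. n ^ (n - m))"
    by (intro sum_mono card_perm_overlap_le) auto
  also have "\<dots> = fact n * (\<Sum>m\<in>?M. n ^ (n - m))"
    by (simp add: card_permutations)
  also have "\<dots> \<le> n ^ n * (\<Sum>m\<in>?M. n ^ (n - m))"
    using fact_le_power[of n, where 'a = nat] by (intro mult_right_mono) auto
  also have "\<dots> = (\<Sum>m\<in>?M. n ^ (2 * n - m))"
    by (simp add: sum_distrib_left mult_2 flip: power_add)
  finally have "real (card {(\<pi>\<^sub>1, \<pi>\<^sub>2). \<pi>\<^sub>1 permutes {1..n} \<and> \<pi>\<^sub>2 permutes {1..n} \<and>
      r < real (perm_overlap n \<pi>\<^sub>1 \<pi>\<^sub>2)}) \<le> (\<Sum>m\<in>?M. real n ^ (2 * n - m))"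
    unfolding of_nat_power[symmetric] of_nat_sum[symmetric] of_nat_le_iff .
  also have "\<dots> \<le> (\<Sum>m\<in>?M. exp ((2 * real n - r) * ln (real n)))"
  proof (intro sum_mono)
    fix m assume m: "m \<in> ?M"
    have "real n ^ (2 * n - m) = exp (real (2 * n - m) * ln (real n))"
      using n by (simp add: exp_of_nat_mult)
    also have "\<dots> \<le> exp ((2 * real n - r) * ln (real n))"
      using m n by (auto intro!: mult_right_mono simp: of_nat_diff)
    finally show "real n ^ (2 * n - m) \<le> exp ((2 * real n - r) * ln (real n))" .
  qed
  also have "\<dots> \<le> (real n + 1) * exp ((2 * real n - r) * ln (real n))"
  proof -
    have "card ?M \<le> card {..n}" by (intro card_mono) auto
    then show ?thesis by (auto intro!: mult_right_mono)
  qed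
  finally show ?thesis .
qed

section \<open>Chernoff and union bounds\<close>

text \<open>Exponential Markov inequality for the sum of the two edge overlaps, which on the event
  is at least the sum of both thresholds. \<open>r\<close> bounds the number of edges fixed by the
  comparison of the two permutations.\<close>

lemma prob_good_perms_le:
  fixes n :: nat and p \<beta> \<theta> :: real
  assumes p: "0 \<le> p" "p \<le> 1" and \<theta>: "0 \<le> \<theta>"
    and \<pi>\<^sub>1: "\<pi>\<^sub>1 permutes {1..n}" and \<pi>\<^sub>2: "\<pi>\<^sub>2 permutes {1..n}"
    and r: "real (perm_overlap n \<pi>\<^sub>1 \<pi>\<^sub>2) \<le> r"
  defines "N \<equiv> real (n choose 2)" and "a \<equiv> exp \<theta> - 1"
  shows "measure_pmf.prob (pair_pmf (correlated_instance n p \<alpha>) (erdos_renyi n p))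
      {((G\<^sub>1, G\<^sub>2), H). \<pi>\<^sub>1 \<in> good_perms n p \<beta> G\<^sub>1 H \<and> \<pi>\<^sub>2 \<in> good_perms n p \<beta> G\<^sub>2 H}
    \<le> exp (N * (p * (exp (2 * p * a) - 1)) +
        (r\<^sup>2 / 2 + real n) * (p * exp (2 * p * a) * (exp (p * a\<^sup>2) - 1)) +
        N * (p\<^sup>2 * exp (2 * (2 * p * a + p * a\<^sup>2)) * (exp (3 * (p * a\<^sup>2)) - 1)) -
        \<theta> * (2 * N * p\<^sup>2 + 2 * \<beta> * scale_D n p))"
    (is "measure_pmf.prob ?J ?A \<le> exp (?B - ?t)")
proof -
  let ?O = "\<lambda>((G\<^sub>1, G\<^sub>2), H). \<theta> * (edge_overlap n G\<^sub>1 H \<pi>\<^sub>1 + edge_overlap n G\<^sub>2 H \<pi>\<^sub>2)"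
  have finJ: "finite (set_pmf ?J)"
    by (simp add: finite_set_pmf_correlated_instance erdos_renyi_def finite_set_pmf_random_edges)
  have "measure_pmf.prob ?J ?A = measure_pmf.expectation ?J (indicator ?A)"
    by simp
  also have "\<dots> \<le> measure_pmf.expectation ?J (\<lambda>x. exp (- ?t) * exp (?O x))"
  proof (intro expectation_mono_finite finJ)
    fix x :: "(graph \<times> graph) \<times> graph"
    obtain G\<^sub>1 G\<^sub>2 H where x: "x = ((G\<^sub>1, G\<^sub>2), H)" by (metis surj_pair)
    show "indicator ?A x \<le> exp (- ?t) * exp (?O x)"
    proof (cases "x \<in> ?A")
      case True
      then have "2 * N * p\<^sup>2 + 2 * \<beta> * scale_D n p \<le> edge_overlap n G\<^sub>1 H \<pi>\<^sub>1 + edge_overlap n G\<^sub>2 H \<pi>\<^sub>2"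
        by (simp add: x good_perms_def centered_overlap_def N_def)
      then have "?t \<le> ?O x"
        using \<theta> by (simp add: x mult_left_mono)
      then show ?thesis using True by (simp add: flip: exp_add)
    qed simp
  qed
  also have "\<dots> = exp (- ?t) * measure_pmf.expectation ?J (\<lambda>x. exp (?O x))"
    by simp
  also have "\<dots> \<le> exp (- ?t) * exp ?B"
  proof (intro mult_left_mono)
    let ?F = "real (card {e \<in> set (edge_list n). \<pi>\<^sub>1 ` e = \<pi>\<^sub>2 ` e})"
    have "?F \<le> r\<^sup>2 / 2 + real n"
      using card_edges_same_image_le[OF \<pi>\<^sub>1 \<pi>\<^sub>2] power_mono[OF r, of 2] by simp
    then have "?F * (p * exp (2 * p * a) * (exp (p * a\<^sup>2) - 1)) \<le>
        (r\<^sup>2 / 2 + real n) * (p * exp (2 * p * a) * (exp (p * a\<^sup>2) - 1))"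
      using p by (intro mult_right_mono) auto
    moreover have "measure_pmf.expectation ?J (\<lambda>x. exp (?O x)) \<le>
        exp (N * (p * (exp (2 * p * a) - 1)) + ?F * (p * exp (2 * p * a) * (exp (p * a\<^sup>2) - 1)) +
        N * (p\<^sup>2 * exp (2 * (2 * p * a + p * a\<^sup>2)) * (exp (3 * (p * a\<^sup>2)) - 1)))"
      using expectation_exp_edge_overlaps[OF p \<theta> \<pi>\<^sub>1 \<pi>\<^sub>2, of \<alpha>]
      by (simp only: N_def a_def case_prod_unfold)
    ultimately show "measure_pmf.expectation ?J (\<lambda>x. exp (?O x)) \<le> exp ?B"
      by (elim order_trans) simp
  qed simp
  also have "\<dots> = exp (?B - ?t)"
    by (simp only: exp_add[symmetric] uminus_add_conv_diff)
  finally show ?thesis .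
qed

text \<open>Union bound over pairs of permutations. The lower end of the overlap window controls the
  number of pairs, the upper end the variance.\<close>

lemma prob_forbidden_structure_le:
  fixes n :: nat and p \<beta> \<theta> \<rho> \<eta> :: real
  assumes p: "0 \<le> p" "p \<le> 1" and \<theta>: "0 \<le> \<theta>" and n: "1 \<le> n"
  defines "N \<equiv> real (n choose 2)" and "a \<equiv> exp \<theta> - 1"
  shows "measure_pmf.prob (pair_pmf (correlated_instance n p \<alpha>) (erdos_renyi n p))
      {((G\<^sub>1, G\<^sub>2), H). forbidden_structure n p \<beta> \<rho> \<eta> G\<^sub>1 G\<^sub>2 H}
    \<le> (real n + 1) * exp ((2 - \<rho> + \<eta>) * (real n * ln (real n)) +
        N * (p * (exp (2 * p * a) - 1)) +
        (((\<rho> + \<eta>) * real n)\<^sup>2 / 2 + real n) * (p * exp (2 * p * a) * (exp (p * a\<^sup>2) - 1)) +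
        N * (p\<^sup>2 * exp (2 * (2 * p * a + p * a\<^sup>2)) * (exp (3 * (p * a\<^sup>2)) - 1)) -
        \<theta> * (2 * N * p\<^sup>2 + 2 * \<beta> * scale_D n p))"
    (is "measure_pmf.prob ?J ?A \<le> (real n + 1) * exp (?L + ?B1 + ?B2 + ?B3 - ?t)")
proof -
  let ?I = "{(\<pi>\<^sub>1, \<pi>\<^sub>2). \<pi>\<^sub>1 permutes {1..n} \<and> \<pi>\<^sub>2 permutes {1..n} \<and>
      real (perm_overlap n \<pi>\<^sub>1 \<pi>\<^sub>2) \<in> {(\<rho> - \<eta>) * real n <..< (\<rho> + \<eta>) * real n}}"
  let ?I' = "{(\<pi>\<^sub>1, \<pi>\<^sub>2). \<pi>\<^sub>1 permutes {1..n} \<and> \<pi>\<^sub>2 permutes {1..n} \<and>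
      (\<rho> - \<eta>) * real n < real (perm_overlap n \<pi>\<^sub>1 \<pi>\<^sub>2)}"
  let ?E = "\<lambda>(\<pi>\<^sub>1, \<pi>\<^sub>2). {((G\<^sub>1, G\<^sub>2), H). \<pi>\<^sub>1 \<in> good_perms n p \<beta> G\<^sub>1 H \<and> \<pi>\<^sub>2 \<in> good_perms n p \<beta> G\<^sub>2 H}"
  have fin': "finite ?I'"
    by (rule finite_subset[of _ "{\<pi>. \<pi> permutes {1..n}} \<times> {\<pi>. \<pi> permutes {1..n}}"])
      (auto intro: finite_permutations)
  have sub: "?I \<subseteq> ?I'" by auto
  have fin: "finite ?I" using finite_subset[OF sub fin'] .
  have "?A \<subseteq> (\<Union>z\<in>?I. ?E z)"
    unfolding forbidden_structure_def by (fastforce simp: good_perms_def)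
  then have "measure_pmf.prob ?J ?A \<le> measure_pmf.prob ?J (\<Union>z\<in>?I. ?E z)"
    by (intro measure_pmf.finite_measure_mono) auto
  also have "\<dots> \<le> (\<Sum>z\<in>?I. measure_pmf.prob ?J (?E z))"
    by (intro measure_pmf.finite_measure_subadditive_finite fin) auto
  also have "\<dots> \<le> (\<Sum>z\<in>?I. exp (?B1 + ?B2 + ?B3 - ?t))"
  proof (intro sum_mono)
    fix z assume "z \<in> ?I"
    then obtain \<pi>\<^sub>1 \<pi>\<^sub>2 where z: "z = (\<pi>\<^sub>1, \<pi>\<^sub>2)" "\<pi>\<^sub>1 permutes {1..n}" "\<pi>\<^sub>2 permutes {1..n}"
      "real (perm_overlap n \<pi>\<^sub>1 \<pi>\<^sub>2) \<le> (\<rho> + \<eta>) * real n" by auto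
    show "measure_pmf.prob ?J (?E z) \<le> exp (?B1 + ?B2 + ?B3 - ?t)"
      using prob_good_perms_le[OF p \<theta> z(2-4), of \<alpha> \<beta>] by (simp add: z(1) N_def a_def)
  qed
  also have "\<dots> = real (card ?I) * exp (?B1 + ?B2 + ?B3 - ?t)"
    by simp
  also have "\<dots> \<le> ((real n + 1) * exp ((2 * real n - (\<rho> - \<eta>) * real n) * ln (real n))) * exp (?B1 + ?B2 + ?B3 - ?t)"
    using card_perm_pairs_le[OF n, of "(\<rho> - \<eta>) * real n"] card_mono[OF fin' sub]
    by (intro mult_right_mono) auto
  also have "\<dots> = (real n + 1) * exp (?L + ?B1 + ?B2 + ?B3 - ?t)"
  proof -
    have "(2 * real n - (\<rho> - \<eta>) * real n) * ln (real n) = ?L" by (simp add: algebra_simps)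
    then show ?thesis by (simp only: mult.assoc exp_add[symmetric] add_diff_eq add.assoc)
  qed
  finally show ?thesis .
qed

section \<open>Expansion of the exponent and choice of the Chernoff parameter\<close>

text \<open>The coefficient of \<open>x\<^sup>2\<close> has to be exact: applied to
  \<open>exp \<theta> - 1\<close>, it produces the leading variance term
  \<open>N * p\<^sup>2 * \<theta>\<^sup>2\<close>.\<close>

lemma exp_le_cubic:
  fixes x :: real
  assumes "0 \<le> x" "x \<le> 1 / 2"
  shows "exp x \<le> 1 + x + x\<^sup>2 / 2 + x ^ 3"
proof -
  obtain t where t: "\<bar>t\<bar> \<le> \<bar>x\<bar>" "exp x = (\<Sum>m<3. x ^ m / fact m) + exp t / fact 3 * x ^ 3"
    using Maclaurin_exp_le[of x 3] by blast
  have "exp t \<le> exp (1 / 2)" using t(1) assms by simp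
  also have "\<dots> \<le> 6" using exp_bound[of "1 / 2 :: real"] by (simp add: power2_eq_square)
  finally have "exp t / 6 * x ^ 3 \<le> 1 * x ^ 3"
    using assms by (intro mult_right_mono) auto
  then show ?thesis
    unfolding t(2) by (simp add: eval_nat_numeral)
qed

text \<open>The main term \<open>2 N p\<^sup>2 \<theta>\<close> is exact because it has to cancel the centring of both overlaps.\<close>

lemma log_mgf_bound:
  fixes p \<theta> \<epsilon> N F :: real
  assumes p: "0 \<le> p" "p \<le> \<epsilon>" and \<theta>: "0 \<le> \<theta>" "\<theta> \<le> \<epsilon>" and \<epsilon>: "\<epsilon> \<le> 1 / 8"
    and N: "0 \<le> N" and F: "0 \<le> F"
  defines "a \<equiv> exp \<theta> - 1"
  shows "N * (p * (exp (2 * p * a) - 1)) + F * (p * exp (2 * p * a) * (exp (p * a\<^sup>2) - 1)) +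
        N * (p\<^sup>2 * exp (2 * (2 * p * a + p * a\<^sup>2)) * (exp (3 * (p * a\<^sup>2)) - 1))
    \<le> 2 * N * p\<^sup>2 * \<theta> + (1 + 120 * \<epsilon>) * (N + F) * (p\<^sup>2 * \<theta>\<^sup>2)"
proof -
  have exp2: "exp x \<le> 1 + x + x\<^sup>2" if "0 \<le> x" "x \<le> 1" for x :: real
    using exp_bound[OF that] .
  have a: "0 \<le> a" "a \<le> \<theta> + \<theta>\<^sup>2 / 2 + \<theta> ^ 3" "a \<le> \<theta> * (1 + \<epsilon>)" "a \<le> 2 * \<theta>" "a \<le> 1 / 4"
  proof -
    show "0 \<le> a" using \<theta> by (simp add: a_def)
    show "a \<le> \<theta> + \<theta>\<^sup>2 / 2 + \<theta> ^ 3"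
      using exp_le_cubic[of \<theta>] \<theta> \<epsilon> by (simp add: a_def)
    have "a \<le> \<theta> * (1 + \<theta>)"
      using exp2[of \<theta>] \<theta> \<epsilon> by (simp add: a_def power2_eq_square algebra_simps)
    also have "\<dots> \<le> \<theta> * (1 + \<epsilon>)" using \<theta> by (intro mult_left_mono) auto
    finally show 1: "a \<le> \<theta> * (1 + \<epsilon>)" .
    also have "\<dots> \<le> \<theta> * 2" using \<theta> \<epsilon> by (intro mult_left_mono) auto
    finally show "a \<le> 2 * \<theta>" by simp
    then show "a \<le> 1 / 4" using \<theta> \<epsilon> by simp
  qed
  have p8: "p \<le> 1 / 8" and \<epsilon>0: "0 \<le> \<epsilon>" using p \<epsilon> by auto
  have a2: "a\<^sup>2 \<le> \<theta>\<^sup>2 * (1 + \<epsilon>)\<^sup>2" "a\<^sup>2 \<le> 4 * \<theta>\<^sup>2" "a\<^sup>2 \<le> 1 / 16"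
    using power_mono[OF a(3) a(1), of 2] power_mono[OF a(4) a(1), of 2] power_mono[OF a(5) a(1), of 2]
    by (simp_all add: power_mult_distrib power_divide)
  have pa: "p * a \<le> 1 / 32" "p * a \<le> 2 * \<epsilon> / 8" "0 \<le> p * a"
    using mult_mono[OF p8 a(5)] mult_mono[OF p(2) a(5)] p a(1) by auto
  have pa2: "p * a\<^sup>2 \<le> 1 / 128" "p * a\<^sup>2 \<le> \<epsilon>" "0 \<le> p * a\<^sup>2"
    using mult_mono[OF p8 a2(3)] mult_mono[OF p(2) a2(3)] p \<epsilon>0 by auto
  let ?q = "p\<^sup>2 * \<theta>\<^sup>2"
  have q0: "0 \<le> ?q" by simp
  have pq: "p * ?q \<le> \<epsilon> * ?q" "\<theta> * ?q \<le> \<epsilon> * ?q"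
    using p \<theta> by (auto intro!: mult_right_mono)
  \<comment> \<open>The summand \<open>\<theta>\<^sup>2 / 2\<close> in the bound of \<open>a\<close>
    gives \<open>?q\<close> with coefficient 1; the cubic term and the square of
    \<open>2 * p * a\<close> are errors of size \<open>\<epsilon> * ?q\<close>.\<close>
  have 1: "p * (exp (2 * p * a) - 1) \<le> 2 * p\<^sup>2 * \<theta> + ?q * (1 + 18 * \<epsilon>)"
  proof -
    have "p * (exp (2 * p * a) - 1) \<le> p * (2 * p * a + (2 * p * a)\<^sup>2)"
      using exp2[of "2 * p * a"] pa p by (intro mult_left_mono) (auto simp: mult.assoc)
    also have "\<dots> = p\<^sup>2 * (2 * a) + 4 * p * (p\<^sup>2 * a\<^sup>2)"
      by (simp add: power2_eq_square algebra_simps)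
    also have "\<dots> \<le> p\<^sup>2 * (2 * (\<theta> + \<theta>\<^sup>2 / 2 + \<theta> ^ 3)) + 4 * p * (p\<^sup>2 * (4 * \<theta>\<^sup>2))"
      using a a2 p by (intro add_mono mult_left_mono) auto
    also have "\<dots> = 2 * p\<^sup>2 * \<theta> + ?q + 2 * (\<theta> * ?q) + 16 * (p * ?q)"
      by (simp add: power2_eq_square power3_eq_cube algebra_simps)
    also have "\<dots> \<le> 2 * p\<^sup>2 * \<theta> + ?q + 2 * (\<epsilon> * ?q) + 16 * (\<epsilon> * ?q)"
      using pq by (intro add_mono mult_left_mono order_refl) auto
    finally show ?thesis by (simp add: algebra_simps)
  qed
  \<comment> \<open>Fixed edges enter at full strength: to leading order each contributes
    \<open>p * (p * a\<^sup>2)\<close>, that is \<open>?q\<close>.\<close>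
  have 2: "p * exp (2 * p * a) * (exp (p * a\<^sup>2) - 1) \<le> ?q * (1 + 120 * \<epsilon>)"
  proof -
    have e1: "exp (2 * p * a) \<le> 1 + \<epsilon>"
    proof -
      have "(2 * (p * a))\<^sup>2 \<le> (2 * (p * a)) * 1"
        unfolding power2_eq_square using pa by (intro mult_left_mono) auto
      moreover have "exp (2 * (p * a)) \<le> 1 + 2 * (p * a) + (2 * (p * a))\<^sup>2"
        using pa by (intro exp2) auto
      ultimately show ?thesis using pa unfolding mult.assoc by linarith
    qed
    have e2: "exp (p * a\<^sup>2) - 1 \<le> p * a\<^sup>2 * (1 + \<epsilon>)"
    proof -
      have "(p * a\<^sup>2)\<^sup>2 \<le> (p * a\<^sup>2) * \<epsilon>"
        unfolding power2_eq_square[of "p * a\<^sup>2"] using pa2 by (intro mult_left_mono) auto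
      then show ?thesis using exp2[of "p * a\<^sup>2"] pa2 by (simp add: algebra_simps)
    qed
    have "p * exp (2 * p * a) * (exp (p * a\<^sup>2) - 1) \<le> p * (1 + \<epsilon>) * (p * a\<^sup>2 * (1 + \<epsilon>))"
      using p \<epsilon>0 e1 e2 by (intro mult_mono) auto
    also have "\<dots> = p\<^sup>2 * (1 + \<epsilon>)\<^sup>2 * a\<^sup>2" by (simp add: power2_eq_square algebra_simps)
    also have "\<dots> \<le> p\<^sup>2 * (1 + \<epsilon>)\<^sup>2 * (\<theta>\<^sup>2 * (1 + \<epsilon>)\<^sup>2)"
      using a2 by (intro mult_left_mono) auto
    also have "\<dots> = ?q * ((1 + \<epsilon>)\<^sup>2)\<^sup>2" by (simp add: power2_eq_square algebra_simps)
    also have "\<dots> \<le> ?q * (1 + 120 * \<epsilon>)"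
    proof (intro mult_left_mono q0)
      have "\<epsilon>\<^sup>2 \<le> \<epsilon>" using \<epsilon> \<epsilon>0 by (simp add: power2_eq_square mult_left_le)
      then have "((1 + \<epsilon>)\<^sup>2)\<^sup>2 \<le> (1 + 3 * \<epsilon>)\<^sup>2"
        using \<epsilon>0 by (intro power_mono) (auto simp: power2_sum)
      also have "\<dots> \<le> 1 + 120 * \<epsilon>"
        using \<open>\<epsilon>\<^sup>2 \<le> \<epsilon>\<close> \<epsilon>0 by (simp add: power2_sum power_mult_distrib)
      finally show "((1 + \<epsilon>)\<^sup>2)\<^sup>2 \<le> 1 + 120 * \<epsilon>" .
    qed
    finally show ?thesis .
  qed
  \<comment> \<open>A nonfixed pair needs two edges of \<open>H\<close>, and the extra factor
    \<open>p\<close> makes this an error term.\<close>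
  have 3: "p\<^sup>2 * exp (2 * (2 * p * a + p * a\<^sup>2)) * (exp (3 * (p * a\<^sup>2)) - 1) \<le> ?q * (48 * \<epsilon>)"
  proof -
    define x where "x = 2 * (2 * p * a + p * a\<^sup>2)"
    have x: "0 \<le> x" "x \<le> 1 / 2" using pa pa2 by (auto simp: x_def mult.assoc)
    then have "x\<^sup>2 \<le> (1 / 2)\<^sup>2" by (intro power_mono) auto
    then have e1: "exp x \<le> 2" using exp2[of x] x by (simp add: power_divide)
    have "(3 * (p * a\<^sup>2))\<^sup>2 \<le> 3 * (p * a\<^sup>2) * 1"
      unfolding power2_eq_square[of "3 * (p * a\<^sup>2)"] using pa2 by (intro mult_left_mono) auto
    then have e2: "exp (3 * (p * a\<^sup>2)) - 1 \<le> 6 * (p * a\<^sup>2)"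
      using exp2[of "3 * (p * a\<^sup>2)"] pa2 by simp
    have "p\<^sup>2 * exp x * (exp (3 * (p * a\<^sup>2)) - 1) \<le> p\<^sup>2 * 2 * (6 * (p * a\<^sup>2))"
      using p e1 e2 by (intro mult_mono) auto
    also have "\<dots> = 12 * p\<^sup>2 * p * a\<^sup>2" by simp
    also have "\<dots> \<le> 12 * p\<^sup>2 * p * (4 * \<theta>\<^sup>2)"
      using a2 p by (intro mult_left_mono) auto
    also have "\<dots> = 48 * (p * ?q)" by simp
    also have "\<dots> \<le> 48 * (\<epsilon> * ?q)" using pq by simp
    finally show ?thesis by (simp add: x_def mult_ac)
  qed
  have "N * (p * (exp (2 * p * a) - 1)) + F * (p * exp (2 * p * a) * (exp (p * a\<^sup>2) - 1)) +
        N * (p\<^sup>2 * exp (2 * (2 * p * a + p * a\<^sup>2)) * (exp (3 * (p * a\<^sup>2)) - 1)) \<le>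
    N * (2 * p\<^sup>2 * \<theta> + ?q * (1 + 18 * \<epsilon>)) + F * (?q * (1 + 120 * \<epsilon>)) + N * (?q * (48 * \<epsilon>))"
    using N F 1 2 3 by (intro add_mono mult_left_mono)
  \<comment> \<open>The errors 18 and 48 at \<open>N\<close> add up to 66, which leaves 54 of the
    120.\<close>
  also have "\<dots> = 2 * N * p\<^sup>2 * \<theta> + (1 + 120 * \<epsilon>) * (N + F) * ?q - N * (?q * (54 * \<epsilon>))"
    by (simp add: algebra_simps)
  also have "\<dots> \<le> 2 * N * p\<^sup>2 * \<theta> + (1 + 120 * \<epsilon>) * (N + F) * ?q"
    using N \<epsilon>0 by simp
  finally show ?thesis .
qed

text \<open>The choice \<open>\<theta> = (c / p) sqrt (ln n / n)\<close> makes the variance and threshold terms of the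
  Chernoff bound all of order \<open>n ln n\<close>.\<close>

lemma prob_forbidden_structure_le_exp:
  fixes n :: nat and p \<beta> \<rho> \<eta> c \<epsilon> :: real
  assumes p: "0 < p" "p \<le> \<epsilon>" and n: "1 \<le> n" and c: "0 \<le> c" and \<epsilon>: "\<epsilon> \<le> 1 / 8"
    and \<theta>: "c * sqrt (ln (real n) / real n) \<le> \<epsilon> * p"
  shows "measure_pmf.prob (pair_pmf (correlated_instance n p \<alpha>) (erdos_renyi n p))
      {((G\<^sub>1, G\<^sub>2), H). forbidden_structure n p \<beta> \<rho> \<eta> G\<^sub>1 G\<^sub>2 H}
    \<le> (real n + 1) * exp ((2 - \<rho> + \<eta> + (1 + 120 * \<epsilon>) * c\<^sup>2 * ((1 + (\<rho> + \<eta>)\<^sup>2) / 2 + 1 / real n)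
        - 2 * \<beta> * c) * (real n * ln (real n)))"
proof -
  define L where "L = ln (real n)"
  define \<theta> where "\<theta> = c * sqrt (L / real n) / p"
  define N where "N = real (n choose 2)"
  define F where "F = ((\<rho> + \<eta>) * real n)\<^sup>2 / 2 + real n"
  define a where "a = exp \<theta> - 1"
  have L0: "0 \<le> L" using n by (simp add: L_def)
  have \<theta>0: "0 \<le> \<theta>" using c p L0 by (simp add: \<theta>_def)
  have \<theta>\<epsilon>: "\<theta> \<le> \<epsilon>"
    using assms(6) p by (simp add: \<theta>_def L_def divide_le_eq)
  have sq: "p\<^sup>2 * \<theta>\<^sup>2 = c\<^sup>2 * (L / real n)"
    using p L0 by (simp add: \<theta>_def power_divide power_mult_distrib)
  have D: "\<theta> * scale_D n p = c * (real n * L)"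
  proof -
    have "real n ^ 3 * p\<^sup>2 * L = (real n * p)\<^sup>2 * (real n * L)"
      by (simp add: power2_eq_square power3_eq_cube)
    then have "scale_D n p = sqrt ((real n * p)\<^sup>2) * sqrt (real n * L)"
      by (simp only: scale_D_def L_def[symmetric] real_sqrt_mult)
    then have "scale_D n p = real n * p * sqrt (real n * L)"
      using p by simp
    moreover have "sqrt (L / real n) * sqrt (real n * L) = L"
      using L0 n by (simp flip: real_sqrt_mult)
    ultimately show ?thesis
      using p by (simp add: \<theta>_def)
  qed
  have N_le: "N \<le> (real n)\<^sup>2 / 2"
  proof -
    have "2 * (n choose 2) \<le> n * n"
      by (simp add: choose_two diff_mult_distrib2)
    then show ?thesis
      by (simp add: N_def power2_eq_square flip: of_nat_mult)
  qed
  let ?B = "N * (p * (exp (2 * p * a) - 1)) + F * (p * exp (2 * p * a) * (exp (p * a\<^sup>2) - 1)) +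
        N * (p\<^sup>2 * exp (2 * (2 * p * a + p * a\<^sup>2)) * (exp (3 * (p * a\<^sup>2)) - 1))"
  have "?B \<le> 2 * N * p\<^sup>2 * \<theta> + (1 + 120 * \<epsilon>) * (N + F) * (p\<^sup>2 * \<theta>\<^sup>2)"
    unfolding a_def using p \<epsilon> \<theta>0 \<theta>\<epsilon> by (intro log_mgf_bound) (auto simp: N_def F_def)
  also have "\<dots> \<le> 2 * N * p\<^sup>2 * \<theta> + (1 + 120 * \<epsilon>) * ((real n)\<^sup>2 / 2 + F) * (p\<^sup>2 * \<theta>\<^sup>2)"
    using N_le p by (intro add_left_mono mult_right_mono mult_left_mono) auto
  \<comment> \<open>By \<open>sq\<close>, the two quadratic terms give
    \<open>(1 + (\<rho> + \<eta>)\<^sup>2) / 2\<close>, and the summand \<open>real n\<close> of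
    \<open>F\<close>, from edges with exchanged endpoints, gives \<open>1 / real n\<close>.\<close>
  also have "(1 + 120 * \<epsilon>) * ((real n)\<^sup>2 / 2 + F) * (p\<^sup>2 * \<theta>\<^sup>2) =
      ((1 + 120 * \<epsilon>) * c\<^sup>2 * ((1 + (\<rho> + \<eta>)\<^sup>2) / 2 + 1 / real n)) * (real n * L)"
  proof -
    have "((real n)\<^sup>2 / 2 + F) * (L / real n) = ((1 + (\<rho> + \<eta>)\<^sup>2) / 2 + 1 / real n) * (real n * L)"
      using n by (simp add: F_def field_simps power2_eq_square)
    then show ?thesis unfolding sq by (metis mult.assoc mult.left_commute)
  qed
  finally have "?B \<le> 2 * N * p\<^sup>2 * \<theta> +
      ((1 + 120 * \<epsilon>) * c\<^sup>2 * ((1 + (\<rho> + \<eta>)\<^sup>2) / 2 + 1 / real n)) * (real n * L)" .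
  moreover have "\<theta> * (2 * N * p\<^sup>2 + 2 * \<beta> * scale_D n p) = 2 * N * p\<^sup>2 * \<theta> + 2 * \<beta> * (\<theta> * scale_D n p)"
    by (simp add: algebra_simps)
  \<comment> \<open>The mean \<open>2 * N * p\<^sup>2 * \<theta>\<close> cancels the centring of the
    two overlaps.\<close>
  ultimately have B: "?B - \<theta> * (2 * N * p\<^sup>2 + 2 * \<beta> * scale_D n p) \<le>
      ((1 + 120 * \<epsilon>) * c\<^sup>2 * ((1 + (\<rho> + \<eta>)\<^sup>2) / 2 + 1 / real n) - 2 * \<beta> * c) * (real n * L)"
    unfolding D left_diff_distrib mult.assoc[of "2 * \<beta>" c] by linarith
  have "measure_pmf.prob (pair_pmf (correlated_instance n p \<alpha>) (erdos_renyi n p))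
      {((G\<^sub>1, G\<^sub>2), H). forbidden_structure n p \<beta> \<rho> \<eta> G\<^sub>1 G\<^sub>2 H}
    \<le> (real n + 1) * exp ((2 - \<rho> + \<eta>) * (real n * L) +
        (?B - \<theta> * (2 * N * p\<^sup>2 + 2 * \<beta> * scale_D n p)))"
    using prob_forbidden_structure_le[of p \<theta> n \<alpha> \<beta> \<rho> \<eta>] p \<epsilon> n \<theta>0
    by (simp add: N_def F_def a_def L_def add_diff_eq add.assoc)
  also have "\<dots> \<le> (real n + 1) * exp ((2 - \<rho> + \<eta>) * (real n * L) +
      ((1 + 120 * \<epsilon>) * c\<^sup>2 * ((1 + (\<rho> + \<eta>)\<^sup>2) / 2 + 1 / real n) - 2 * \<beta> * c) * (real n * L))"
    using B by (intro mult_left_mono) auto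
  finally show ?thesis
    by (simp add: L_def algebra_simps)
qed

section \<open>Optimization of the exponent and asymptotics\<close>

theorem proposition4p3:
  fixes p :: "nat \<Rightarrow> real" and \<rho>\<^sub>0 \<beta>\<^sub>0 \<eta> \<alpha> :: real
  assumes "\<And>n. 0 \<le> p n \<and> p n \<le> 1"
    and "(\<lambda>n. sqrt (ln (real n) / real n)) \<in> o(p)"
    and "p \<in> o(\<lambda>_. 1)"
    and "\<rho>\<^sub>0 = 1 / 3"
    and "sqrt (25 / 27) < \<beta>\<^sub>0" and "\<beta>\<^sub>0 < 1"
    and "\<eta> > 0"
    and "2 - \<rho>\<^sub>0 + \<eta> - 2 * \<beta>\<^sub>0\<^sup>2 / (1 + (\<rho>\<^sub>0 + \<eta>)\<^sup>2) < 0"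
    and "0 \<le> \<alpha>" and "\<alpha> \<le> 1"
  shows "(\<lambda>n. measure_pmf.prob
            (pair_pmf (correlated_instance n (p n) \<alpha>) (erdos_renyi n (p n)))
            {((G\<^sub>1, G\<^sub>2), H). forbidden_structure n (p n) \<beta>\<^sub>0 \<rho>\<^sub>0 \<eta> G\<^sub>1 G\<^sub>2 H})
         \<in> o(\<lambda>n. 1 / (real n)\<^sup>2)"
proof -
  define q where "q = 1 + (\<rho>\<^sub>0 + \<eta>)\<^sup>2"
  \<comment> \<open>This value minimizes \<open>c\<^sup>2 * q / 2 - 2 * \<beta>\<^sub>0 * c\<close>,
    with minimum \<open>- (2 * \<beta>\<^sub>0\<^sup>2 / q)\<close>.\<close>
  define c where "c = 2 * \<beta>\<^sub>0 / q"
  \<comment> \<open>The gap in the assumed inequality. Two thirds of it will absorb errors, and one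
    third remains as the rate of decay.\<close>
  define \<Delta> where "\<Delta> = 2 * \<beta>\<^sub>0\<^sup>2 / q - (2 - \<rho>\<^sub>0 + \<eta>)"
  have q: "1 \<le> q" by (simp add: q_def)
  have \<Delta>: "0 < \<Delta>" using assms(8) by (simp add: \<Delta>_def q_def)
  have "0 \<le> sqrt (25 / 27 :: real)" by simp
  then have \<beta>: "0 < \<beta>\<^sub>0" using assms(5) by linarith
  then have c: "0 < c" using q by (simp add: c_def)
  \<comment> \<open>The bound \<open>1 / 8\<close> is required by \<open>log_mgf_bound\<close>; the
    other one makes the error \<open>60 * \<epsilon> * (c\<^sup>2 * q)\<close> at most
    \<open>\<Delta> / 3\<close>.\<close>
  define \<epsilon> where "\<epsilon> = min (1 / 8) (\<Delta> / (180 * c\<^sup>2 * q))"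
  have \<epsilon>: "0 < \<epsilon>" "\<epsilon> \<le> 1 / 8" using \<Delta> c q by (auto simp: \<epsilon>_def)
  have "\<epsilon> \<le> \<Delta> / (180 * c\<^sup>2 * q)" by (simp add: \<epsilon>_def)
  then have \<epsilon>\<Delta>: "60 * \<epsilon> * (c\<^sup>2 * q) \<le> \<Delta> / 3"
    using c q by (simp add: field_simps)
  have exponent: "c\<^sup>2 * q / 2 - 2 * \<beta>\<^sub>0 * c = - (2 * \<beta>\<^sub>0\<^sup>2 / q)"
    using q by (simp add: c_def field_simps power2_eq_square)
  have ev_p: "eventually (\<lambda>n. p n \<le> \<epsilon>) sequentially"
    using landau_o.smallD[OF assms(3) \<epsilon>(1)] by eventually_elim simp
  \<comment> \<open>The lower bound on the density says that
    \<open>\<theta> = (c / p n) * sqrt (ln n / n)\<close> is eventually at most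
    \<open>\<epsilon>\<close>.\<close>
  have ev_\<theta>: "eventually (\<lambda>n. sqrt (ln (real n) / real n) \<le> \<epsilon> / c * p n) sequentially"
    using landau_o.smallD[OF assms(2) divide_pos_pos[OF \<epsilon>(1) c]] eventually_gt_at_top[of 1]
    by eventually_elim (use \<epsilon> c assms(1) in auto)
  have ev_n: "eventually (\<lambda>n. (1 + 120 * \<epsilon>) * c\<^sup>2 * (1 / real n) \<le> \<Delta> / 3) sequentially"
  proof -
    have "(\<lambda>n. (1 + 120 * \<epsilon>) * c\<^sup>2 * (1 / real n)) \<longlonglongrightarrow> 0"
      by real_asymp
    then have "eventually (\<lambda>n. (1 + 120 * \<epsilon>) * c\<^sup>2 * (1 / real n) < \<Delta> / 3) sequentially"
      using \<Delta> by (intro order_tendstoD) auto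
    then show ?thesis by eventually_elim simp
  qed
  have "(\<lambda>n. measure_pmf.prob
            (pair_pmf (correlated_instance n (p n) \<alpha>) (erdos_renyi n (p n)))
            {((G\<^sub>1, G\<^sub>2), H). forbidden_structure n (p n) \<beta>\<^sub>0 \<rho>\<^sub>0 \<eta> G\<^sub>1 G\<^sub>2 H})
      \<in> O(\<lambda>n. (real n + 1) * exp (- (\<Delta> / 3) * (real n * ln (real n))))"
  proof (rule bigoI[where c = 1])
    show "\<forall>\<^sub>F n in sequentially. norm (measure_pmf.prob
            (pair_pmf (correlated_instance n (p n) \<alpha>) (erdos_renyi n (p n)))
            {((G\<^sub>1, G\<^sub>2), H). forbidden_structure n (p n) \<beta>\<^sub>0 \<rho>\<^sub>0 \<eta> G\<^sub>1 G\<^sub>2 H})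
      \<le> 1 * norm ((real n + 1) * exp (- (\<Delta> / 3) * (real n * ln (real n))))"
      using ev_p ev_\<theta> ev_n eventually_gt_at_top[of 1]
    proof eventually_elim
      case (elim n)
      \<comment> \<open>For \<open>n > 1\<close> the logarithm is positive, so
        \<open>ev_\<theta>\<close> also forces \<open>p n > 0\<close>, which permits division by
        it.\<close>
      have "0 < sqrt (ln (real n) / real n)" using elim(4) by simp
      then have "0 < \<epsilon> / c * p n" using elim(2) by linarith
      then have pn: "0 < p n" using \<epsilon> c by (simp add: zero_less_mult_iff zero_less_divide_iff)
      have "c * sqrt (ln (real n) / real n) \<le> \<epsilon> * p n"
        using mult_left_mono[OF elim(2), of c] c by simp
      from prob_forbidden_structure_le_exp[OF pn elim(1) _ _ \<epsilon>(2) this, of \<alpha> \<beta>\<^sub>0 \<rho>\<^sub>0 \<eta>]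
      have "measure_pmf.prob (pair_pmf (correlated_instance n (p n) \<alpha>) (erdos_renyi n (p n)))
            {((G\<^sub>1, G\<^sub>2), H). forbidden_structure n (p n) \<beta>\<^sub>0 \<rho>\<^sub>0 \<eta> G\<^sub>1 G\<^sub>2 H}
        \<le> (real n + 1) * exp ((2 - \<rho>\<^sub>0 + \<eta> + (1 + 120 * \<epsilon>) * c\<^sup>2 * (q / 2 + 1 / real n)
            - 2 * \<beta>\<^sub>0 * c) * (real n * ln (real n)))"
        using elim(4) c by (simp add: q_def)
      also have "2 - \<rho>\<^sub>0 + \<eta> + (1 + 120 * \<epsilon>) * c\<^sup>2 * (q / 2 + 1 / real n) - 2 * \<beta>\<^sub>0 * c =
          - \<Delta> + 60 * \<epsilon> * (c\<^sup>2 * q) + (1 + 120 * \<epsilon>) * c\<^sup>2 * (1 / real n)"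
        using exponent by (simp add: \<Delta>_def algebra_simps)
      also have "(real n + 1) * exp (\<dots> * (real n * ln (real n))) \<le>
          (real n + 1) * exp (- (\<Delta> / 3) * (real n * ln (real n)))"
      proof (intro mult_left_mono exp_mono mult_right_mono)
        show "- \<Delta> + 60 * \<epsilon> * (c\<^sup>2 * q) + (1 + 120 * \<epsilon>) * c\<^sup>2 * (1 / real n) \<le> - (\<Delta> / 3)"
          using \<epsilon>\<Delta> elim(3) by linarith
      qed (use elim(4) in auto)
      finally show ?case by simp
    qed
  qed
  \<comment> \<open>Decay of order \<open>n ln n\<close> in the exponent beats every power of
    \<open>n\<close>.\<close>
  also have "(\<lambda>n. (real n + 1) * exp (- (\<Delta> / 3) * (real n * ln (real n)))) \<in> o(\<lambda>n. 1 / (real n)\<^sup>2)"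
    using \<Delta> by real_asymp
  finally show ?thesis .
qed

end
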